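(* Let $T$ be a finite rooted tree with root $r$, $L$ a set, and $c$ a finite coloring of $\mathrm{W}^T_L$. For every sequence $(d_n)_{n\in\omega}$ in $\omega$ and every sequence $(\mathcal{F}_n)_{n\in\omega}$ where each $\mathcal F_n$ is a finite set of variable substitution maps for $T,L$, there exist sequences $(b_{t,n})_{n\in\omega}$ with $b_{t,n}\in\mathrm{W}^T_{L,t}$, for $t\in T$, such that: (a) for every $n\in\omega$ and $t\in T$ the length of $b_{t,n}$ is at least $d_n$; (b) for every $\ell\in\omega$, $n_0<\cdots<n_\ell$ in $\omega$, $t_0,\dots,t_\ell\in T$ and variable substitution maps $\sigma_j\in\mathcal F_{n_j}$ ($j\le\ell$) such that $\{f_{\sigma_0}(t_0),\dots,f_{\sigma_\ell}(t_\ell)\}$ is a chain in $T$ with least element $t$, the color of $\tau_{\sigma_0}(b_{t_0,n_0})+\cdots+\tau_{\sigma_\ell}(b_{t_\ell,n_\ell})$ depends only on $t$.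
   Context: $\omega=\{0,1,2,\dots\}$. A finite rooted tree $T$ with root $r$ is ordered by $t'\le t$ iff $t'$ is a descendant of $t$ or equal to it; $T^+=T\setminus\{r\}$, whose elements are regarded as variables (assumed disjoint from $L$). A regressive homomorphism of $T$ is $f:T\to T$ with $f(t)\ge t$ for all $t$ that maps any two adjacent nodes to the same node or to adjacent nodes. $\mathrm{W}^T_L$ is the set of finite words (strings) in the alphabet $L\cup T^+$, with $+$ denoting concatenation. $\mathrm{W}^T_{L,r}$ is the set of words with all symbols in $L$; for $t\in T^+$, $\mathrm{W}^T_{L,t}$ is the set of words whose occurring variables (symbols from $T^+$) form a nonempty chain in $T$ with least element $t$. A variable substitution map for $T,L$ is a function $\sigma:T^+\cup L\to T^+\cup L$ with $\sigma|_L=\mathrm{id}_L$ such that $f_\sigma:T\to T$, $f_\sigma(t)=\sigma(t)$ if $t\in T^+$ and $\sigma(t)\in T^+$, $f_\sigma(t)=r$ otherwise, is a regressive homomorphism. $\tau_\sigma(b)$ is the word obtained from $b$ by replacing each occurrence of each symbol $x$ by $\sigma(x)$.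
   Formalization: Regressive homomorphisms are also required to preserve the tree order (otherwise the claim fails, e.g. on the path r > s > t with t sent to a letter and s fixed), and in (a) the length bound is not claimed for t = r when L is empty, where only the empty word exists. *)

theory Defs
  imports Main "HOL-Library.FuncSet"
begin

text \<open>
  A rooted tree is given by its set of nodes \<open>T\<close>, its root \<open>r\<close> and the function sending each
  non-root node to its parent; the value \<open>parent r\<close> is irrelevant.
\<close>

definition parent_rel :: "'a set \<Rightarrow> 'a \<Rightarrow> ('a \<Rightarrow> 'a) \<Rightarrow> 'a rel" where
  "parent_rel T r parent = {(t, parent t) | t. t \<in> T - {r}}"

definition finite_rooted_tree :: "'a set \<Rightarrow> 'a \<Rightarrow> ('a \<Rightarrow> 'a) \<Rightarrow> bool" where
  "finite_rooted_tree T r parent \<longleftrightarrow>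
     finite T \<and> r \<in> T \<and> (\<forall>t \<in> T - {r}. parent t \<in> T) \<and>
     (\<forall>t \<in> T. (t, r) \<in> (parent_rel T r parent)\<^sup>*)"

text \<open>\<open>(t', t) \<in> tree_order T r parent\<close> means \<open>t' \<le> t\<close>; in particular the root is the greatest node.\<close>

definition tree_order :: "'a set \<Rightarrow> 'a \<Rightarrow> ('a \<Rightarrow> 'a) \<Rightarrow> 'a rel" where
  "tree_order T r parent = {(t', t). t' \<in> T \<and> t \<in> T \<and> (t', t) \<in> (parent_rel T r parent)\<^sup>*}"

definition adjacent :: "'a set \<Rightarrow> 'a \<Rightarrow> ('a \<Rightarrow> 'a) \<Rightarrow> 'a \<Rightarrow> 'a \<Rightarrow> bool" where
  "adjacent T r parent s t \<longleftrightarrow> (s, t) \<in> parent_rel T r parent \<or> (t, s) \<in> parent_rel T r parent"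

definition chain_with_least :: "'a set \<Rightarrow> 'a \<Rightarrow> ('a \<Rightarrow> 'a) \<Rightarrow> 'a set \<Rightarrow> 'a \<Rightarrow> bool" where
  "chain_with_least T r parent C t \<longleftrightarrow>
     C \<in> Chains (tree_order T r parent) \<and> t \<in> C \<and> (\<forall>s \<in> C. (t, s) \<in> tree_order T r parent)"

text \<open>
  A homomorphism of the ordered tree is required to preserve the order. Together with the
  adjacency condition this says that a child of \<open>t\<close> is mapped to \<open>f t\<close> or to a child of \<open>f t\<close>.
  The order must be preserved explicitly, since regressive maps that respect only undirected
  adjacency need not do so: on the path with \<open>r\<close> above \<open>s\<close> above \<open>t\<close>, fixing \<open>r\<close> and \<open>s\<close> and
  sending \<open>t\<close> to \<open>r\<close> is such a map. It turns a word whose variables are \<open>s\<close> and \<open>t\<close> into one that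
  still contains \<open>s\<close>, rather than into a word over \<open>L\<close>, and for substitutions inducing such maps
  the Ramsey statement fails (colour each word by its first variable).
\<close>

definition regressive_hom :: "'a set \<Rightarrow> 'a \<Rightarrow> ('a \<Rightarrow> 'a) \<Rightarrow> ('a \<Rightarrow> 'a) \<Rightarrow> bool" where
  "regressive_hom T r parent f \<longleftrightarrow>
     f \<in> T \<rightarrow> T \<and>
     (\<forall>t \<in> T. (t, f t) \<in> tree_order T r parent) \<and>
     (\<forall>s t. (s, t) \<in> tree_order T r parent \<longrightarrow> (f s, f t) \<in> tree_order T r parent) \<and>
     (\<forall>s t. adjacent T r parent s t \<longrightarrow> f s = f t \<or> adjacent T r parent (f s) (f t))"

text \<open>
  The variables are the non-root nodes themselves, so letters and nodes share a type, and
  \<open>(T - {r}) \<inter> L = {}\<close> is assumed where both occur.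
\<close>

definition tree_words :: "'a set \<Rightarrow> 'a \<Rightarrow> 'a set \<Rightarrow> 'a list set" where
  "tree_words T r L = lists (L \<union> (T - {r}))"

definition tree_words_at ::
    "'a set \<Rightarrow> 'a \<Rightarrow> ('a \<Rightarrow> 'a) \<Rightarrow> 'a set \<Rightarrow> 'a \<Rightarrow> 'a list set" where
  "tree_words_at T r parent L t =
     (if t = r then lists L
      else {w \<in> tree_words T r L. chain_with_least T r parent (set w \<inter> (T - {r})) t})"

definition induced_map :: "'a set \<Rightarrow> 'a \<Rightarrow> ('a \<Rightarrow> 'a) \<Rightarrow> 'a \<Rightarrow> 'a" where
  "induced_map T r \<sigma> t = (if t \<in> T - {r} \<and> \<sigma> t \<in> T - {r} then \<sigma> t else r)"

definition var_subst :: "'a set \<Rightarrow> 'a \<Rightarrow> ('a \<Rightarrow> 'a) \<Rightarrow> 'a set \<Rightarrow> ('a \<Rightarrow> 'a) \<Rightarrow> bool" where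
  "var_subst T r parent L \<sigma> \<longleftrightarrow>
     \<sigma> \<in> (T - {r}) \<union> L \<rightarrow> (T - {r}) \<union> L \<and>
     (\<forall>a \<in> L. \<sigma> a = a) \<and>
     regressive_hom T r parent (induced_map T r \<sigma>)"

definition subst_word :: "('a \<Rightarrow> 'a) \<Rightarrow> 'a list \<Rightarrow> 'a list" where
  "subst_word \<sigma> b = map \<sigma> b"

end

theory Submission
  imports Defs "HOL-Analysis.Function_Topology"
begin

text \<open>
  Since a regressive homomorphism moves the branch above a node \<open>t\<close> onto the branch above its
  image, in steps of at most one, everything reduces to words in a linear sequence of variables
  \<open>1, 2, \<dots>\<close> and to ultrafilters \<open>u\<^sub>k\<close> on the words in the variables \<open>1, \<dots>, k\<close> that are
  idempotent, decreasing (\<open>u\<^sub>i \<star> u\<^sub>k = u\<^sub>k \<star> u\<^sub>i = u\<^sub>k\<close> for \<open>i \<le> k\<close>) and coherent (a substitution inducing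
  \<open>f\<close> maps \<open>u\<^sub>k\<close> to the one with index \<open>f k\<close>).

  Let \<open>p\<close> be a minimal idempotent over the letters and \<open>q \<le> p\<close> an idempotent in one variable; by
  minimality every substitution of a letter maps \<open>q\<close> to \<open>p\<close>. The products \<open>p \<star> q(1) \<star> \<dots> \<star> q(k)\<close> are
  coherent, because a substitution only repeats idempotent factors. So the coherent sequences form a
  nonempty compact semigroup. If \<open>x\<close> is an idempotent in it with \<open>x\<^sub>k \<star> x\<^sub>i = x\<^sub>k\<close> for \<open>i < j\<close>, then
  \<open>x\<^sub>k \<star> \<dots> \<star> x\<^sub>j\<close> (and \<open>x\<^sub>k\<close> for \<open>k < j\<close>) is coherent too, and multiplying by it on the right yields
  an idempotent that absorbs the \<open>j\<close>-th coordinate as well. Once all coordinates are absorbed on the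
  right, \<open>u\<^sub>k = x\<^sub>0 \<star> \<dots> \<star> x\<^sub>k\<close> is as required, and the words are chosen one at a time as in the
  Galvin-Glazer proof of Hindman's theorem.
\<close>

section \<open>Idempotents in compact right topological semigroups\<close>

text \<open>In a Hausdorff space compact sets are closed, so a chain of nonempty compact sets has a
  nonempty compact intersection and Zorn's lemma applies. This serves subsemigroups and left ideals
  alike, both being stable under intersections.\<close>

lemma compact_minimal_exists:
  fixes X :: "'a::t2_space set"
  assumes X: "compact X" "X \<noteq> {}" "\<Phi> X"
    and Inter: "\<And>C. C \<noteq> {} \<Longrightarrow> (\<forall>Y\<in>C. \<Phi> Y) \<Longrightarrow> \<Phi> (\<Inter>C)"
  obtains Y where "Y \<subseteq> X" "compact Y" "Y \<noteq> {}" "\<Phi> Y"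
    "\<And>Z. Z \<subseteq> Y \<Longrightarrow> compact Z \<Longrightarrow> Z \<noteq> {} \<Longrightarrow> \<Phi> Z \<Longrightarrow> Z = Y"
proof -
  define F where "F = {Y. Y \<subseteq> X \<and> compact Y \<and> Y \<noteq> {} \<and> \<Phi> Y}"
  \<comment> \<open>Complements turn the maximal element supplied by Zorn's lemma into a minimal
    set.\<close>
  have "\<exists>M\<in>uminus ` F. \<forall>Z\<in>uminus ` F. M \<subseteq> Z \<longrightarrow> Z = M"
  proof (rule subset_Zorn_nonempty)
    show "uminus ` F \<noteq> {}" using X by (auto simp: F_def)
    fix C assume C: "C \<noteq> {}" "subset.chain (uminus ` F) C"
    define D where "D = uminus ` C"
    have D: "D \<noteq> {}" "D \<subseteq> F" using C by (auto simp: D_def subset.chain_def)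
    have lin: "Y \<subseteq> Z \<or> Z \<subseteq> Y" if "Y \<in> D" "Z \<in> D" for Y Z
      using that C(2) unfolding D_def subset.chain_def by blast
    obtain B where B: "B \<in> D" using D by blast
    have "B \<inter> \<Inter>D \<noteq> {}"
    proof (rule compact_imp_fip)
      show "compact B" using B D by (auto simp: F_def)
      show "closed T" if "T \<in> D" for T using that D by (auto simp: F_def compact_imp_closed)
      fix G assume G: "finite G" "G \<subseteq> D"
      have "insert B G \<noteq> {}" "finite (insert B G)" using G by auto
      then obtain m where m: "m \<in> insert B G" "\<forall>x\<in>insert B G. x \<subseteq> m \<longrightarrow> m = x"
        using finite_has_minimal[of "insert B G"] by blast
      have "m \<subseteq> x" if "x \<in> insert B G" for x
        using m that lin[of m x] G B by blast
      then have "m \<subseteq> B \<inter> \<Inter>G" by blast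
      moreover have "m \<noteq> {}" using m(1) G(2) B D(2) by (auto simp: F_def)
      ultimately show "B \<inter> \<Inter>G \<noteq> {}" by blast
    qed
    moreover have "compact (\<Inter>D)"
    proof -
      have "closed (\<Inter>D)" using D by (intro closed_Inter) (auto simp: F_def compact_imp_closed)
      moreover have "compact B" using B D by (auto simp: F_def)
      ultimately have "compact (B \<inter> \<Inter>D)" by (rule compact_Int_closed[rotated])
      moreover have "B \<inter> \<Inter>D = \<Inter>D" using B by blast
      ultimately show ?thesis by simp
    qed
    moreover have "\<Phi> (\<Inter>D)" using D by (intro Inter) (auto simp: F_def)
    ultimately have "\<Inter>D \<in> F" using B D by (auto simp: F_def)
    moreover have "\<Union>C = - \<Inter>D" unfolding D_def by auto
    ultimately show "\<Union>C \<in> uminus ` F" by blast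
  qed
  then obtain Y where Y: "Y \<in> F" and m: "\<forall>Z\<in>F. - Y \<subseteq> - Z \<longrightarrow> - Z = - Y"
    unfolding bex_simps ball_simps by (elim bexE)
  show thesis
  proof (rule that[of Y])
    show "Y \<subseteq> X" "compact Y" "Y \<noteq> {}" "\<Phi> Y" using Y by (auto simp: F_def)
    fix Z assume Z: "Z \<subseteq> Y" "compact Z" "Z \<noteq> {}" "\<Phi> Z"
    then have "Z \<in> F" using Y by (auto simp: F_def)
    with m Z(1) show "Z = Y" by (metis Compl_subset_Compl_iff double_compl)
  qed
qed

text \<open>The Ellis-Numakura theorem: every element \<open>q\<close> of a minimal compact
  subsemigroup \<open>Y\<close> is idempotent. Continuity is assumed in the left argument
  only.\<close>

theorem ellis_idempotent:
  fixes X :: "'a::t2_space set" and op :: "'a \<Rightarrow> 'a \<Rightarrow> 'a" (infixl "\<cdot>" 70)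
  assumes X: "compact X" "X \<noteq> {}" and closed: "\<And>p q. p \<in> X \<Longrightarrow> q \<in> X \<Longrightarrow> p \<cdot> q \<in> X"
    and assoc: "\<And>p q r. (p \<cdot> q) \<cdot> r = p \<cdot> (q \<cdot> r)"
    and cont: "\<And>q. continuous_on UNIV (\<lambda>p. p \<cdot> q)"
  obtains e where "e \<in> X" "e \<cdot> e = e"
proof -
  obtain Y where Y: "Y \<subseteq> X" "compact Y" "Y \<noteq> {}" "\<forall>p\<in>Y. \<forall>q\<in>Y. p \<cdot> q \<in> Y"
    and min: "\<And>Z. Z \<subseteq> Y \<Longrightarrow> compact Z \<Longrightarrow> Z \<noteq> {} \<Longrightarrow> \<forall>p\<in>Z. \<forall>q\<in>Z. p \<cdot> q \<in> Z \<Longrightarrow> Z = Y"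
    by (rule compact_minimal_exists[OF X, of "\<lambda>Y. \<forall>p\<in>Y. \<forall>q\<in>Y. p \<cdot> q \<in> Y"]) (use closed in auto)
  obtain q where q: "q \<in> Y" using Y by blast
  \<comment> \<open>The right translate of \<open>Y\<close> by \<open>q\<close> is a compact
    subsemigroup of \<open>Y\<close>, so by minimality it contains \<open>q\<close>; hence the set
    \<open>Z\<close> below is nonempty.\<close>
  have "(\<lambda>p. p \<cdot> q) ` Y = Y"
  proof (rule min)
    show "(\<lambda>p. p \<cdot> q) ` Y \<subseteq> Y" "(\<lambda>p. p \<cdot> q) ` Y \<noteq> {}" using Y q by auto
    show "compact ((\<lambda>p. p \<cdot> q) ` Y)"
      by (rule compact_continuous_image[OF continuous_on_subset[OF cont] Y(2)]) auto
    have "p \<cdot> q \<cdot> (p' \<cdot> q) = (p \<cdot> q \<cdot> p') \<cdot> q" for p p' by (simp add: assoc)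
    then show "\<forall>p\<in>(\<lambda>p. p \<cdot> q) ` Y. \<forall>p'\<in>(\<lambda>p. p \<cdot> q) ` Y. p \<cdot> p' \<in> (\<lambda>p. p \<cdot> q) ` Y"
      using Y(4) q by (simp add: image_iff Bex_def) blast
  qed
  then obtain p where p: "p \<in> Y" "p \<cdot> q = q" using q by (metis imageE)
  \<comment> \<open>\<open>Z\<close> is closed by continuity and a subsemigroup by associativity, so
    minimality puts \<open>q\<close> into it.\<close>
  define Z where "Z = Y \<inter> {p. p \<cdot> q = q}"
  have "Z = Y"
  proof (rule min)
    show "Z \<subseteq> Y" "Z \<noteq> {}" using p by (auto simp: Z_def)
    show "compact Z" unfolding Z_def
      by (intro compact_Int_closed Y closed_Collect_eq cont continuous_on_const)
    show "\<forall>p\<in>Z. \<forall>q\<in>Z. p \<cdot> q \<in> Z" using Y(4) by (auto simp: Z_def assoc)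
  qed
  then have "q \<cdot> q = q" using q by (auto simp: Z_def)
  then show thesis using that q Y by blast
qed

section \<open>Ultrafilters of words\<close>

text \<open>The abstract results ask for a Hausdorff type; this makes them apply to families of sets
  and to sequences of such families.\<close>

instance "fun" :: (type, t2_space) t2_space
proof
  fix f g :: "'a \<Rightarrow> 'b" assume "f \<noteq> g"
  then obtain i where "f i \<noteq> g i" by blast
  then obtain U V where UV: "open U" "open V" "f i \<in> U" "g i \<in> V" "U \<inter> V = {}"
    using hausdorff by metis
  have "open ((\<lambda>f. f i) -` W)" if "open W" for W :: "'b set"
    using continuous_on_product_coordinates[of i] that by (metis open_vimage)
  then show "\<exists>U V. open U \<and> open V \<and> f \<in> U \<and> g \<in> V \<and> U \<inter> V = {}"
    using UV by (intro exI[of _ "(\<lambda>f. f i) -` U"] exI[of _ "(\<lambda>f. f i) -` V"]) auto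
qed

text \<open>Tychonoff's theorem. Used once it makes the space of families of sets compact, used
  twice the space of sequences of families.\<close>

lemma compact_UNIV_fun:
  assumes "compact (UNIV :: 'b::topological_space set)"
  shows "compact (UNIV :: ('a \<Rightarrow> 'b) set)"
proof -
  have "compactin (product_topology (\<lambda>i. euclidean) UNIV) (PiE UNIV (\<lambda>i::'a. UNIV :: 'b set))"
    using assms by (subst compactin_PiE) auto
  then show ?thesis by (simp add: euclidean_product_topology)
qed

lemma compact_fun_closed:
  "closed S \<Longrightarrow> compact S" for S :: "('a \<Rightarrow> bool) set"
  using compact_Int_closed[OF compact_UNIV_fun[OF finite_imp_compact[OF finite_UNIV]], of S] by simp

lemma compact_fun_fun_closed:
  "closed S \<Longrightarrow> compact S" for S :: "('c \<Rightarrow> 'a \<Rightarrow> bool) set"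
  using compact_Int_closed[OF compact_UNIV_fun[OF
      compact_UNIV_fun[OF finite_imp_compact[OF finite_UNIV]]], of S] by simp

lemma closed_Collect_bool_fun:
  fixes \<phi> :: "'a::topological_space \<Rightarrow> bool"
  assumes "continuous_on UNIV \<phi>"
  shows "closed {x. \<phi> x}" "closed {x. \<not> \<phi> x}"
  using closed_Collect_eq[OF assms continuous_on_const[of _ True]]
    closed_Collect_eq[OF assms continuous_on_const[of _ False]] by simp_all

text \<open>A family of sets is represented by its characteristic function, so that the ultrafilters
  on a type form a closed subset of a power of the two-point space.\<close>

definition ultra :: "('w set \<Rightarrow> bool) \<Rightarrow> bool" where
  "ultra p \<longleftrightarrow> (\<forall>A B. p (A \<inter> B) \<longleftrightarrow> p A \<and> p B) \<and> (\<forall>A. p (- A) \<longleftrightarrow> \<not> p A)"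

text \<open>The extension of concatenation to the Stone-Cech compactification of the set of words.
  Quantifying over \<open>p\<close> outside \<open>q\<close> makes it continuous in
  \<open>p\<close>.\<close>

definition conv :: "('w list set \<Rightarrow> bool) \<Rightarrow> ('w list set \<Rightarrow> bool) \<Rightarrow> 'w list set \<Rightarrow> bool"
  (infixl "\<star>" 70) where
  "p \<star> q = (\<lambda>A. p {x. q {y. x @ y \<in> A}})"

definition push :: "('v \<Rightarrow> 'w) \<Rightarrow> ('v set \<Rightarrow> bool) \<Rightarrow> 'w set \<Rightarrow> bool" where
  "push h p = (\<lambda>A. p (h -` A))"

lemma ultra_Int: "ultra p \<Longrightarrow> p (A \<inter> B) \<longleftrightarrow> p A \<and> p B"
  and ultra_Compl: "ultra p \<Longrightarrow> p (- A) \<longleftrightarrow> \<not> p A"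
  by (simp_all add: ultra_def)

lemma ultra_empty: "ultra p \<Longrightarrow> \<not> p {}"
  using ultra_Int[of p "{}" "- {}"] ultra_Compl[of p "{}"] by auto

lemma ultra_UNIV: "ultra p \<Longrightarrow> p UNIV"
  using ultra_Compl[of p "{}"] ultra_empty[of p] by simp

lemma ultra_mono: "ultra p \<Longrightarrow> p A \<Longrightarrow> A \<subseteq> B \<Longrightarrow> p B"
  using ultra_Int[of p A B] by (simp add: Int_absorb2)

lemma ultra_nonempty: "ultra p \<Longrightarrow> p A \<Longrightarrow> \<exists>x. x \<in> A"
  using ultra_empty[of p] by (cases "A = {}") auto

lemma ultra_cong: "ultra p \<Longrightarrow> p S \<Longrightarrow> (\<And>x. x \<in> S \<Longrightarrow> x \<in> A \<longleftrightarrow> x \<in> B) \<Longrightarrow> p A \<longleftrightarrow> p B"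
proof -
  assume p: "ultra p" "p S" and "\<And>x. x \<in> S \<Longrightarrow> x \<in> A \<longleftrightarrow> x \<in> B"
  then have "S \<inter> A = S \<inter> B" by blast
  with p show ?thesis using ultra_Int[of p S A] ultra_Int[of p S B] by simp
qed

lemma ultra_Ball:
  assumes "ultra p" "finite I" "\<And>i. i \<in> I \<Longrightarrow> p {x. P i x}"
  shows "p {x. \<forall>i\<in>I. P i x}"
  using assms(2,3)
proof (induction I)
  case empty
  then show ?case using ultra_UNIV[OF assms(1)] by simp
next
  case (insert i I)
  have "p ({x. P i x} \<inter> {x. \<forall>i\<in>I. P i x})"
    using insert unfolding ultra_Int[OF assms(1)] by blast
  then show ?case by (rule ultra_mono[OF assms(1)]) auto
qed

lemma ultra_finite_Union:
  assumes "ultra p" "finite I" "p (\<Union>i\<in>I. A i)"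
  shows "\<exists>i\<in>I. p (A i)"
proof (rule ccontr)
  assume "\<not> ?thesis"
  then have "p {x. \<forall>i\<in>I. x \<in> - A i}"
    by (intro ultra_Ball[OF assms(1,2)]) (simp add: Collect_neg_eq ultra_Compl[OF assms(1)])
  then have "p ({x. \<forall>i\<in>I. x \<in> - A i} \<inter> (\<Union>i\<in>I. A i))"
    using assms(3) unfolding ultra_Int[OF assms(1)] by blast
  moreover have "{x. \<forall>i\<in>I. x \<in> - A i} \<inter> (\<Union>i\<in>I. A i) = {}" by auto
  ultimately show False using ultra_empty[OF assms(1)] by simp
qed

lemma ultra_principal: "ultra (\<lambda>A. x \<in> A)"
  by (simp add: ultra_def)

lemma ultra_push: "ultra p \<Longrightarrow> ultra (push h p)"
  by (simp add: ultra_def push_def vimage_Compl)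

lemma ultra_conv:
  assumes "ultra p" "ultra q"
  shows "ultra (p \<star> q)"
  unfolding ultra_def conv_def
proof safe
  fix A B
  have *: "{x. q {y. x @ y \<in> A \<inter> B}} = {x. q {y. x @ y \<in> A}} \<inter> {x. q {y. x @ y \<in> B}}"
    using ultra_Int[OF assms(2)] by (auto simp: Collect_conj_eq)
  show "p {x. q {y. x @ y \<in> A}}" if "p {x. q {y. x @ y \<in> A \<inter> B}}"
    using that unfolding * by (simp add: ultra_Int[OF assms(1)])
  show "p {x. q {y. x @ y \<in> B}}" if "p {x. q {y. x @ y \<in> A \<inter> B}}"
    using that unfolding * by (simp add: ultra_Int[OF assms(1)])
  show "p {x. q {y. x @ y \<in> A \<inter> B}}" if "p {x. q {y. x @ y \<in> A}}" "p {x. q {y. x @ y \<in> B}}"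
    using that unfolding * by (simp add: ultra_Int[OF assms(1)])
  have **: "{x. q {y. x @ y \<in> - A}} = - {x. q {y. x @ y \<in> A}}"
    using ultra_Compl[OF assms(2)] by (auto simp: Collect_neg_eq)
  show False if "p {x. q {y. x @ y \<in> - A}}" "p {x. q {y. x @ y \<in> A}}"
    using that unfolding ** by (simp add: ultra_Compl[OF assms(1)])
  show "p {x. q {y. x @ y \<in> - A}}" if "\<not> p {x. q {y. x @ y \<in> A}}"
    using that unfolding ** by (simp add: ultra_Compl[OF assms(1)])
qed

lemma conv_assoc: "p \<star> q \<star> r = p \<star> (q \<star> r)"
  by (simp add: conv_def)

lemma conv_mem:
  assumes "ultra p" "ultra q" "p A" "q B" "\<And>x y. x \<in> A \<Longrightarrow> y \<in> B \<Longrightarrow> x @ y \<in> C"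
  shows "(p \<star> q) C"
  unfolding conv_def using assms(5)
  by (intro ultra_mono[OF assms(1,3)] subsetI CollectI ultra_mono[OF assms(2,4)]) auto

lemma push_conv:
  assumes "\<And>x y. h (x @ y) = h x @ h y"
  shows "push h (p \<star> q) = push h p \<star> push h q"
  by (simp add: push_def conv_def assms vimage_def)

lemma push_push: "push h (push h' p) = push (h \<circ> h') p"
  by (simp add: push_def vimage_comp)

lemma push_cong:
  assumes "ultra p" "p S" "\<And>x. x \<in> S \<Longrightarrow> h x = h' x"
  shows "push h p = push h' p"
  unfolding push_def by (intro ext ultra_cong[OF assms(1,2)]) (simp add: assms(3))

lemma push_id_on:
  assumes "ultra p" "p S" "\<And>x. x \<in> S \<Longrightarrow> h x = x"
  shows "push h p = p"
  using push_cong[OF assms(1,2), of h id] assms(3) by (simp add: push_def)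

section \<open>Continuity of products and images of ultrafilters\<close>

lemma continuous_on_coord:
  "continuous_on S \<phi> \<Longrightarrow> continuous_on S (\<lambda>x. \<phi> x i)"
  by (rule continuous_on_product_then_coordinatewise)

lemma continuous_conv: "continuous_on UNIV (\<lambda>p. p \<star> q)"
  unfolding conv_def
  by (intro continuous_on_coordinatewise_then_product continuous_on_product_coordinates)

lemma continuous_push: "continuous_on UNIV \<phi> \<Longrightarrow> continuous_on UNIV (\<lambda>x. push h (\<phi> x))"
  unfolding push_def
  by (rule continuous_on_coordinatewise_then_product) (rule continuous_on_coord)

lemma closed_ultra:
  assumes "continuous_on UNIV \<phi>"
  shows "closed {x. ultra (\<phi> x)}"
proof -
  have c: "closed {x. \<phi> x A}" "closed {x. \<not> \<phi> x A}" for A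
    by (rule closed_Collect_bool_fun[OF continuous_on_coord[OF assms]])+
  \<comment> \<open>An implication defines a closed set when its premise defines an open one, so
    both halves of clopenness are used.\<close>
  have o: "open {x. \<phi> x A}" "open {x. \<not> \<phi> x A}" for A
    using c[of A] by (simp_all add: closed_def Collect_neg_eq)
  show ?thesis unfolding ultra_def iff_conv_conj_imp
    by (intro closed_Collect_conj closed_Collect_all closed_Collect_imp open_Collect_conj c o)
qed

section \<open>Words in a linear sequence of variables\<close>

text \<open>The letters are \<open>Inl a\<close> with \<open>a \<in> L\<close>, and \<open>Inr i\<close> with \<open>i \<ge> 1\<close> stands for the node at
  depth \<open>i\<close> of a branch. The lower bound on the number of occurrences makes long words typical
  for every ultrafilter in \<open>level L k\<close>.\<close>

definition branch_words :: "'a set \<Rightarrow> nat \<Rightarrow> nat \<Rightarrow> ('a + nat) list set" where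
  "branch_words L k d =
     {w \<in> lists (Inl ` L \<union> Inr ` {1..k}). \<forall>i\<in>{1..k}. d \<le> count_list w (Inr i)}"

definition level :: "'a set \<Rightarrow> nat \<Rightarrow> (('a + nat) list set \<Rightarrow> bool) set" where
  "level L k = {p. ultra p \<and> (\<forall>d. p (branch_words L k d))}"

text \<open>The trace of a variable substitution on one branch: \<open>f i\<close> is the depth of
  the image of the node at depth \<open>i\<close>, and \<open>g i\<close> the symbol replacing that
  node, a letter exactly when the image is the root.\<close>

definition branch_subst :: "'a set \<Rightarrow> nat \<Rightarrow> (nat \<Rightarrow> nat) \<Rightarrow> (nat \<Rightarrow> 'a + nat) \<Rightarrow> bool" where
  "branch_subst L k f g \<longleftrightarrow>
     f 0 = 0 \<and> (\<forall>i<k. f (Suc i) = f i \<or> f (Suc i) = Suc (f i)) \<and>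
     (\<forall>i\<in>{1..k}. g i \<in> (if f i = 0 then Inl ` L else {Inr (f i)}))"

definition apply_subst :: "(nat \<Rightarrow> 'a + nat) \<Rightarrow> ('a + nat) list \<Rightarrow> ('a + nat) list" where
  "apply_subst g = map (case_sum Inl g)"

lemma levelD: "p \<in> level L k \<Longrightarrow> ultra p" "p \<in> level L k \<Longrightarrow> p (branch_words L k d)"
  by (simp_all add: level_def)

lemma apply_subst_append: "apply_subst g (x @ y) = apply_subst g x @ apply_subst g y"
  by (simp add: apply_subst_def)

lemmas push_subst_conv = push_conv[of "apply_subst g" for g, OF apply_subst_append]

lemma branch_words_append:
  assumes "x \<in> branch_words L i d" "y \<in> branch_words L k d"
  shows "x @ y \<in> branch_words L (max i k) d"
proof -
  have "x @ y \<in> lists (Inl ` L \<union> Inr ` {1..max i k})"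
    using assms by (fastforce simp: branch_words_def in_lists_conv_set)
  moreover have "d \<le> count_list (x @ y) (Inr l)" if "l \<in> {1..max i k}" for l
  proof (cases "l \<le> i")
    case True
    then show ?thesis using that assms(1) by (simp add: branch_words_def trans_le_add1)
  next
    case False
    then show ?thesis using that assms(2) by (simp add: branch_words_def trans_le_add2)
  qed
  ultimately show ?thesis by (simp add: branch_words_def)
qed

lemma level_conv: "p \<in> level L i \<Longrightarrow> q \<in> level L k \<Longrightarrow> p \<star> q \<in> level L (max i k)"
  unfolding level_def by (auto intro: ultra_conv conv_mem branch_words_append)

lemma branch_subst_Suc: "branch_subst L (Suc k) f g \<Longrightarrow> branch_subst L k f g"
  by (auto simp: branch_subst_def)

lemma branch_subst_le: "branch_subst L k f g \<Longrightarrow> i \<le> k \<Longrightarrow> f i \<le> f k"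
proof (induction k)
  case (Suc k)
  then show ?case
    by (cases "i = Suc k") (auto dest: branch_subst_Suc simp: branch_subst_def)
qed simp

lemma branch_subst_le_self: "branch_subst L k f g \<Longrightarrow> f k \<le> k"
proof (induction k)
  case (Suc k)
  then have "f k \<le> k" by (blast dest: branch_subst_Suc)
  then show ?case using Suc.prems by (auto simp: branch_subst_def)
qed (simp add: branch_subst_def)

text \<open>A discrete intermediate value property: \<open>f\<close> starts at 0 and rises by at
  most 1.\<close>

lemma branch_subst_surj: "branch_subst L k f g \<Longrightarrow> j \<le> f k \<Longrightarrow> \<exists>i\<le>k. f i = j"
proof (induction k)
  case (Suc k)
  show ?case
  proof (cases "j \<le> f k")
    case True
    then show ?thesis using Suc by (meson branch_subst_Suc le_Suc_eq)
  next
    case False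
    then have "j = f (Suc k)" using Suc.prems by (auto simp: branch_subst_def)
    then show ?thesis by blast
  qed
qed (auto simp: branch_subst_def)

lemma count_list_map_ge: "count_list w x \<le> count_list (map h w) (h x)"
  by (induction w) auto

text \<open>Each variable \<open>j\<close> up to \<open>f k\<close> is the image of some variable
  \<open>i\<close>, and all occurrences of \<open>i\<close> become occurrences of \<open>j\<close>,
  so the lower bound \<open>d\<close> survives.\<close>

lemma apply_subst_branch_words:
  assumes "branch_subst L k f g" "w \<in> branch_words L k d"
  shows "apply_subst g w \<in> branch_words L (f k) d"
proof -
  have "case_sum Inl g c \<in> Inl ` L \<union> Inr ` {1..f k}" if "c \<in> set w" for c
  proof -
    have "c \<in> Inl ` L \<union> Inr ` {1..k}" using that assms(2) by (auto simp: branch_words_def)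
    then consider a where "c = Inl a" "a \<in> L" | i where "c = Inr i" "i \<in> {1..k}" by blast
    then show ?thesis
    proof cases
      case 2
      then have "g i \<in> (if f i = 0 then Inl ` L else {Inr (f i)})" "f i \<le> f k"
        using assms(1) branch_subst_le[OF assms(1)] by (auto simp: branch_subst_def)
      then show ?thesis using 2 by (auto split: if_splits)
    qed auto
  qed
  moreover have "d \<le> count_list (apply_subst g w) (Inr j)" if j: "j \<in> {1..f k}" for j
  proof -
    obtain i where i: "i \<le> k" "f i = j" using branch_subst_surj[OF assms(1), of j] j by auto
    have "i \<noteq> 0" using i j assms(1) by (metis atLeastAtMost_iff branch_subst_def not_one_le_zero)
    then have "i \<in> {1..k}" using i by simp
    then have "g i \<in> (if f i = 0 then Inl ` L else {Inr (f i)})" "d \<le> count_list w (Inr i)"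
      using assms unfolding branch_subst_def branch_words_def by blast+
    then have "g i = Inr j" "d \<le> count_list w (Inr i)" using i j by auto
    then show ?thesis using count_list_map_ge[of w "Inr i" "case_sum Inl g"]
      by (simp add: apply_subst_def)
  qed
  ultimately show ?thesis unfolding branch_words_def apply_subst_def by (simp add: in_lists_conv_set)
qed

lemma push_subst_level:
  assumes "branch_subst L k f g" "p \<in> level L k"
  shows "push (apply_subst g) p \<in> level L (f k)"
proof -
  have "push (apply_subst g) p (branch_words L (f k) d)" for d
    unfolding push_def using apply_subst_branch_words[OF assms(1)]
    by (intro ultra_mono[OF levelD[OF assms(2)]]) auto
  then show ?thesis using ultra_push[OF levelD(1)[OF assms(2)]] by (simp add: level_def)
qed

lemma push_subst_level_0:
  assumes "p \<in> level L 0"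
  shows "push (apply_subst g) p = p"
proof (rule push_id_on[OF levelD[OF assms]])
  fix w assume "w \<in> branch_words L 0 0"
  then show "apply_subst g w = w"
    by (induction w) (auto simp: branch_words_def apply_subst_def)
qed

lemma closed_level:
  assumes "continuous_on UNIV \<phi>"
  shows "closed {x. \<phi> x \<in> level L k}"
  unfolding level_def mem_Collect_eq
  by (intro closed_Collect_conj closed_Collect_all closed_ultra assms
      closed_Collect_bool_fun(1) continuous_on_product_then_coordinatewise[OF assms])

lemma compact_level: "compact (level L k)"
  using compact_fun_closed[OF closed_level[of "\<lambda>p. p" L k, OF continuous_on_id]] by simp

text \<open>The principal ultrafilter at the empty word works even if \<open>L\<close> is
  empty.\<close>

lemma level_0_nonempty: "level L 0 \<noteq> {}"
  using ultra_principal[of "[]"] by (auto simp: level_def branch_words_def)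

text \<open>No single word meets every lower bound \<open>d\<close>, but a power of the variable
  meets finitely many of them; compactness does the rest.\<close>

lemma level_1_nonempty: "level L 1 \<noteq> {}"
proof -
  have "{p. ultra p} \<inter> (\<Inter>d. {p. p (branch_words L 1 d)}) \<noteq> {}"
  proof (rule compact_imp_fip_image)
    show "compact {p :: ('a + nat) list set \<Rightarrow> bool. ultra p}"
      using closed_ultra[OF continuous_on_id] by (intro compact_fun_closed) simp
    show "closed {p :: ('a + nat) list set \<Rightarrow> bool. p (branch_words L 1 d)}" for d
      by (intro closed_Collect_bool_fun(1) continuous_on_product_coordinates)
    fix D :: "nat set" assume "finite D"
    then obtain m where "\<forall>d\<in>D. d \<le> m" using finite_nat_set_iff_bounded_le by blast
    moreover have "count_list (replicate m x) x = m" for x :: "'a + nat"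
      by (induction m) auto
    ultimately have "replicate m (Inr 1) \<in> branch_words L 1 d" if "d \<in> D" for d
      using that by (auto simp: branch_words_def in_lists_conv_set)
    then show "{p. ultra p} \<inter> (\<Inter>d\<in>D. {p. p (branch_words L 1 d)}) \<noteq> {}"
      using ultra_principal[of "replicate m (Inr 1)"] by blast
  qed
  then show ?thesis by (auto simp: level_def)
qed

section \<open>The Hales-Jewett ultrafilters\<close>

text \<open>Minimality of \<open>p\<close> forces every idempotent of \<open>level L 0\<close> below \<open>p\<close>, such as the image of \<open>q\<close>
  under the substitution of a letter, to be \<open>p\<close> itself.\<close>

theorem hales_jewett_ultrafilters:
  fixes L :: "'a set"
  obtains p q where "p \<in> level L 0" "q \<in> level L 1" "p \<star> p = p" "q \<star> q = q"
    "p \<star> q = q" "q \<star> p = q"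
    "\<And>a. a \<in> L \<Longrightarrow> push (apply_subst (\<lambda>_. Inl a)) q = p"
proof -
  \<comment> \<open>\<open>M\<close> is a minimal compact left ideal of
    \<open>level L 0\<close>.\<close>
  obtain M where M: "M \<subseteq> level L 0" "compact M" "M \<noteq> {}" "\<forall>s\<in>level L 0. \<forall>x\<in>M. s \<star> x \<in> M"
    and min: "\<And>Z. Z \<subseteq> M \<Longrightarrow> compact Z \<Longrightarrow> Z \<noteq> {} \<Longrightarrow> \<forall>s\<in>level L 0. \<forall>x\<in>Z. s \<star> x \<in> Z \<Longrightarrow> Z = M"
    by (rule compact_minimal_exists[OF compact_level level_0_nonempty, of "\<lambda>Z. \<forall>s\<in>level L 0. \<forall>x\<in>Z. s \<star> x \<in> Z"])
      (use level_conv[of _ L 0 _ 0] in auto)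
  obtain p where p: "p \<in> M" "p \<star> p = p"
    by (rule ellis_idempotent[OF M(2,3), of conv]) (use M in \<open>auto simp: conv_assoc continuous_conv\<close>)
  have p0: "p \<in> level L 0" using p M by blast
  \<comment> \<open>Since \<open>e \<star> p = e\<close>, the left ideal
    \<open>level L 0 \<star> e\<close> lies in \<open>M\<close>. By minimality it is
    \<open>M\<close> and contains \<open>p\<close>, whence \<open>p \<star> e = p\<close>.\<close>
  have idem_eq: "e = p" if e: "e \<in> level L 0" "e \<star> e = e" "p \<star> e = e" "e \<star> p = e" for e
  proof -
    have "(\<lambda>s. s \<star> e) ` level L 0 = M"
    proof (rule min)
      have "s \<star> e \<in> M" if "s \<in> level L 0" for s
      proof -
        have "s \<star> e = s \<star> e \<star> p" using e by (simp add: conv_assoc)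
        moreover have "s \<star> e \<in> level L 0" using level_conv[OF that e(1)] by simp
        ultimately show ?thesis using M(4) p by metis
      qed
      then show "(\<lambda>s. s \<star> e) ` level L 0 \<subseteq> M" by blast
      show "compact ((\<lambda>s. s \<star> e) ` level L 0)"
        by (rule compact_continuous_image[OF continuous_on_subset[OF continuous_conv] compact_level]) auto
      show "(\<lambda>s. s \<star> e) ` level L 0 \<noteq> {}" using level_0_nonempty by blast
      show "\<forall>s\<in>level L 0. \<forall>x\<in>(\<lambda>s. s \<star> e) ` level L 0. s \<star> x \<in> (\<lambda>s. s \<star> e) ` level L 0"
        using level_conv[of _ L 0 _ 0] by (auto simp flip: conv_assoc)
    qed
    then obtain s where "p = s \<star> e" using p by blast
    then have "p \<star> e = p" using e by (simp add: conv_assoc)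
    then show ?thesis using e by simp
  qed
  \<comment> \<open>Every element of \<open>J\<close> ends in the factor \<open>p\<close>, so the
    idempotent \<open>q\<close> satisfies \<open>q \<star> p = q\<close>. Multiplying by
    \<open>p\<close> on the left then yields \<open>u\<close>, absorbed on both sides.\<close>
  define J where "J = (\<lambda>x. x \<star> p) ` level L 1"
  have J1: "J \<subseteq> level L 1" using level_conv[of _ L 1 p 0] p0 by (auto simp: J_def)
  obtain q where q: "q \<in> J" "q \<star> q = q"
  proof (rule ellis_idempotent[of J conv])
    show "compact J" unfolding J_def
      by (rule compact_continuous_image[OF continuous_on_subset[OF continuous_conv] compact_level]) auto
    show "J \<noteq> {}" using level_1_nonempty by (auto simp: J_def)
    fix x y assume "x \<in> J" "y \<in> J"
    then obtain z where "y = z \<star> p" "x \<in> level L 1" "z \<in> level L 1" using J1 by (auto simp: J_def)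
    then show "x \<star> y \<in> J" using level_conv[of x L 1 z 1] by (auto simp: J_def simp flip: conv_assoc)
  qed (auto simp: conv_assoc continuous_conv)
  have qp: "q \<star> p = q" using q p by (auto simp: J_def conv_assoc)
  define u where "u = p \<star> q"
  have u: "u \<in> level L 1" using level_conv[OF p0, of q 1] q J1 by (auto simp: u_def)
  have "p \<star> q \<star> (p \<star> q) = p \<star> (q \<star> p \<star> q)" by (simp add: conv_assoc)
  then have uu: "u \<star> u = u" by (simp add: u_def qp q)
  have pu: "p \<star> u = u" "u \<star> p = u" by (simp_all add: u_def p qp conv_assoc flip: conv_assoc[of p p])
  show thesis
  proof (rule that[of p u])
    fix a assume a: "a \<in> L"
    let ?h = "apply_subst (\<lambda>_. Inl a)"
    have pp: "push ?h p = p" by (rule push_subst_level_0[OF p0])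
    have "branch_subst L 1 (\<lambda>_. 0) (\<lambda>_. Inl a)" using a by (simp add: branch_subst_def)
    from push_subst_level[OF this u] have "push ?h u \<in> level L 0" .
    \<comment> \<open>Substituting a letter commutes with \<open>\<star>\<close> and fixes
      \<open>p\<close>, so the relations between \<open>u\<close> and \<open>p\<close> pass to the
      image of \<open>u\<close>, to which \<open>idem_eq\<close> applies.\<close>
    then show "push ?h u = p"
      using push_subst_conv[of "\<lambda>_. Inl a" u u] push_subst_conv[of "\<lambda>_. Inl a" u p]
        push_subst_conv[of "\<lambda>_. Inl a" p u] by (intro idem_eq) (simp_all only: uu pu pp)
  qed (use p p0 u uu pu in auto)
qed

section \<open>Coherent sequences of idempotents\<close>

definition coherent :: "'a set \<Rightarrow> (nat \<Rightarrow> ('a + nat) list set \<Rightarrow> bool) set" where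
  "coherent L = {v. \<forall>k. v k \<in> level L k \<and>
     (\<forall>f g. branch_subst L k f g \<longrightarrow> push (apply_subst g) (v k) = v (f k))}"

definition pconv :: "(nat \<Rightarrow> 'w list set \<Rightarrow> bool) \<Rightarrow> (nat \<Rightarrow> 'w list set \<Rightarrow> bool) \<Rightarrow>
    nat \<Rightarrow> 'w list set \<Rightarrow> bool" where
  "pconv v w = (\<lambda>k. v k \<star> w k)"

lemma pconv_assoc: "pconv (pconv u v) w = pconv u (pconv v w)"
  by (simp add: pconv_def conv_assoc)

lemma continuous_pconv: "continuous_on UNIV (\<lambda>v. pconv v w)"
  unfolding pconv_def
proof (rule continuous_on_coordinatewise_then_product)
  show "continuous_on UNIV (\<lambda>v. v k \<star> w k)" for k
    by (rule continuous_on_compose2[OF continuous_conv continuous_on_product_coordinates]) auto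
qed

lemma coherentD:
  "v \<in> coherent L \<Longrightarrow> v k \<in> level L k"
  "v \<in> coherent L \<Longrightarrow> branch_subst L k f g \<Longrightarrow> push (apply_subst g) (v k) = v (f k)"
  by (simp_all add: coherent_def)

lemma coherent_pconv: "v \<in> coherent L \<Longrightarrow> w \<in> coherent L \<Longrightarrow> pconv v w \<in> coherent L"
  unfolding coherent_def pconv_def
  using level_conv[of "v k" L k "w k" k for k] by (auto simp: push_subst_conv)

lemma closed_coherent: "closed (coherent L)"
  unfolding coherent_def
  by (intro closed_Collect_all closed_Collect_conj closed_level closed_Collect_imp
      closed_Collect_eq continuous_push continuous_on_product_coordinates open_Collect_const)

text \<open>The starting point is \<open>p \<star> q(1) \<star> \<dots> \<star> q(k)\<close>, where \<open>q(i)\<close> is a copy of the Hales-Jewett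
  ultrafilter \<open>q\<close> in the variable \<open>i\<close>: a substitution merely repeats some of the idempotent factors.\<close>

lemma coherent_nonempty: "coherent L \<noteq> {}"
proof -
  obtain p q where p: "p \<in> level L 0" "p \<star> p = p" and q: "q \<in> level L 1" "q \<star> q = q"
    and pq: "p \<star> q = q" and lett: "\<And>a. a \<in> L \<Longrightarrow> push (apply_subst (\<lambda>_. Inl a)) q = p"
    using hales_jewett_ultrafilters[of L] by metis
  define Q where "Q i = push (apply_subst (\<lambda>_. Inr i)) q" for i
  have QQ: "Q i \<star> Q i = Q i" for i unfolding Q_def by (simp flip: push_subst_conv add: q)
  have push_Q: "push (apply_subst g) (Q i) = push (apply_subst (\<lambda>_. g i)) q" for g i
  proof -
    have "apply_subst g \<circ> apply_subst (\<lambda>_. Inr i) = apply_subst (\<lambda>_. g i)"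
      by (auto simp: apply_subst_def fun_eq_iff split: sum.split)
    then show ?thesis by (simp add: Q_def push_push)
  qed
  define y where "y = rec_nat p (\<lambda>k x. x \<star> Q (Suc k))"
  have y0: "y 0 = p" and ySuc: "y (Suc k) = y k \<star> Q (Suc k)" for k by (simp_all add: y_def)
  have "y k \<in> level L k" for k
  proof (induction k)
    case 0
    then show ?case using p y0 by simp
  next
    case (Suc k)
    have uQ: "ultra (Q (Suc k))" unfolding Q_def by (intro ultra_push levelD[OF q(1)])
    show ?case unfolding level_def ySuc
    proof (intro CollectI conjI allI)
      show "ultra (y k \<star> Q (Suc k))" by (rule ultra_conv[OF levelD(1)[OF Suc] uQ])
      fix d
      show "(y k \<star> Q (Suc k)) (branch_words L (Suc k) d)"
      proof (rule conv_mem[OF levelD(1)[OF Suc] uQ levelD(2)[OF Suc]])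
        show "Q (Suc k) (apply_subst (\<lambda>_. Inr (Suc k)) ` branch_words L 1 d)"
          unfolding Q_def push_def by (rule ultra_mono[OF levelD[OF q(1)]]) auto
        fix x z assume x: "x \<in> branch_words L k d"
          and "z \<in> apply_subst (\<lambda>_. Inr (Suc k)) ` branch_words L 1 d"
        then obtain w where w: "w \<in> branch_words L 1 d" "z = apply_subst (\<lambda>_. Inr (Suc k)) w"
          by blast
        have z: "set z \<subseteq> Inl ` L \<union> {Inr (Suc k)}"
          using w by (auto simp: branch_words_def apply_subst_def in_lists_conv_set)
        have dz: "d \<le> count_list z (Inr (Suc k))"
          using w count_list_map_ge[of w "Inr 1" "case_sum Inl (\<lambda>_. Inr (Suc k))"]
          by (auto simp: branch_words_def apply_subst_def)
        have "set x \<subseteq> Inl ` L \<union> Inr ` {1..k}"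
          using x by (simp add: branch_words_def lists_eq_set)
        moreover have "Inr ` {1..Suc k} = insert (Inr (Suc k)) (Inr ` {1..k} :: ('a + nat) set)"
          by (simp add: atLeastAtMostSuc_conv)
        ultimately have "set (x @ z) \<subseteq> Inl ` L \<union> Inr ` {1..Suc k}"
          using z unfolding set_append by blast
        moreover have "d \<le> count_list (x @ z) (Inr i)" if "i \<in> {1..Suc k}" for i
          using that x dz by (cases "i = Suc k") (auto simp: branch_words_def trans_le_add1)
        ultimately show "x @ z \<in> branch_words L (Suc k) d"
          by (simp add: branch_words_def lists_eq_set)
      qed
    qed
  qed
  moreover have "push (apply_subst g) (y k) = y (f k)" if "branch_subst L k f g" for k f g
    using that
  proof (induction k)
    case 0
    then show ?case using push_subst_level_0[OF p(1)] by (simp add: y0 branch_subst_def)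
  next
    case (Suc k)
    have *: "push (apply_subst g) (y (Suc k)) = y (f k) \<star> push (apply_subst (\<lambda>_. g (Suc k))) q"
      unfolding ySuc push_subst_conv push_Q using Suc branch_subst_Suc by metis
    have g: "g (Suc k) \<in> (if f (Suc k) = 0 then Inl ` L else {Inr (f (Suc k))})"
      and f: "f (Suc k) = f k \<or> f (Suc k) = Suc (f k)"
      using Suc.prems by (auto simp: branch_subst_def)
    show ?case
    proof (cases "f (Suc k)")
      \<comment> \<open>Here \<open>f k = 0\<close> as well, so the last factor becomes a second
        copy of \<open>p\<close>.\<close>
      case 0
      then obtain a where "g (Suc k) = Inl a" "a \<in> L" using g by auto
      then show ?thesis using 0 f by (simp add: * lett y0 p)
    next
      \<comment> \<open>If \<open>f\<close> stays constant, the last factor repeats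
        \<open>Q (Suc l)\<close> and is absorbed; if \<open>f\<close> rises, it is exactly the new
        last factor of \<open>y (Suc l)\<close>.\<close>
      case (Suc l)
      then have "push (apply_subst (\<lambda>_. g (Suc k))) q = Q (Suc l)" using g by (simp add: Q_def)
      moreover have "y (f k) = y l \<or> y (f k) = y l \<star> Q (Suc l)"
        using f Suc ySuc[of l] by auto
      ultimately show ?thesis unfolding * Suc by (auto simp: ySuc conv_assoc QQ)
    qed
  qed
  ultimately show ?thesis unfolding coherent_def by blast
qed

text \<open>The translate of \<open>S\<close> by \<open>m\<close> is a compact semigroup. Its
  idempotents end in the factor \<open>m\<close> and so inherit every absorption on the right that
  \<open>m\<close> has.\<close>

lemma pconv_idempotent:
  assumes "closed S" "m \<in> S"
    and "\<And>v w. v \<in> S \<Longrightarrow> w \<in> S \<Longrightarrow> pconv v w \<in> S"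
  obtains v where "v \<in> S" "pconv (pconv v m) (pconv v m) = pconv v m"
proof -
  have "compact ((\<lambda>v. pconv v m) ` S)"
    by (rule compact_continuous_image[OF continuous_on_subset[OF continuous_pconv]
          compact_fun_fun_closed[OF assms(1)]]) auto
  moreover have "pconv v w \<in> (\<lambda>v. pconv v m) ` S"
    if vw: "v \<in> (\<lambda>v. pconv v m) ` S" "w \<in> (\<lambda>v. pconv v m) ` S" for v w
  proof -
    obtain v' w' where v: "v = pconv v' m" "v' \<in> S" and w: "w = pconv w' m" "w' \<in> S"
      using vw by blast
    have "pconv v w = pconv (pconv (pconv v' m) w') m" by (simp add: v w pconv_assoc)
    then show ?thesis using v w assms(2,3) by blast
  qed
  ultimately obtain e where "e \<in> (\<lambda>v. pconv v m) ` S" "pconv e e = e"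
    using ellis_idempotent[of "(\<lambda>v. pconv v m) ` S" pconv] assms(2) pconv_assoc continuous_pconv
    by (metis empty_iff image_is_empty)
  then show thesis using that by blast
qed

text \<open>Induction on the number of absorbed coordinates: the new idempotent gets a right factor
  ending in \<open>x j\<close> from \<open>j\<close> on, while its coordinates up to
  \<open>j\<close> remain those of \<open>x\<close>, so nothing gained earlier is lost.\<close>

lemma coherent_right_absorbing:
  "\<exists>x\<in>coherent L. pconv x x = x \<and> (\<forall>i<j. \<forall>k\<ge>i. x k \<star> x i = x k)"
proof (induction j)
  case 0
  obtain y where y: "y \<in> coherent L" using coherent_nonempty by blast
  obtain v where "v \<in> coherent L" "pconv (pconv v y) (pconv v y) = pconv v y"
    by (rule pconv_idempotent[OF closed_coherent y coherent_pconv])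
  then show ?case using coherent_pconv[OF _ y] by blast
next
  case (Suc j)
  then obtain x where x: "x \<in> coherent L" "pconv x x = x"
    and abs: "\<And>i k. i < j \<Longrightarrow> i \<le> k \<Longrightarrow> x k \<star> x i = x k" by blast
  have idem: "x k \<star> x k = x k" for k using fun_cong[OF x(2), of k] by (simp add: pconv_def)
  \<comment> \<open>From \<open>j\<close> on, \<open>m k\<close> is the descending product
    \<open>x k \<star> ... \<star> x j\<close>.\<close>
  define m where "m = rec_nat (x 0) (\<lambda>k p. if Suc k \<le> j then x (Suc k) else x (Suc k) \<star> p)"
  have m0: "m 0 = x 0"
    and mSuc: "m (Suc k) = (if Suc k \<le> j then x (Suc k) else x (Suc k) \<star> m k)" for k
    by (simp_all add: m_def)
  have m_le: "m k = x k" if "k \<le> j" for k using that by (cases k) (simp_all add: m0 mSuc)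
  have m_abs: "x k \<star> m k = m k" for k
    by (cases k) (simp_all add: m0 mSuc idem flip: conv_assoc)
  have m_j: "m k \<star> x j = m k" if "j \<le> k" for k
    using that
  proof (induction k rule: dec_induct)
    case base
    then show ?case by (simp add: m_le idem)
  next
    case (step k)
    then show ?case by (simp add: mSuc conv_assoc)
  qed
  \<comment> \<open>Up to \<open>j\<close> this is the absorption already known for
    \<open>x\<close>; beyond \<open>j\<close> it is the recursion. Together with
    \<open>m_abs\<close> it makes \<open>m\<close> coherent.\<close>
  have m_step: "x (Suc l) \<star> m l = m (Suc l)" for l
    using abs[of l "Suc l"] by (cases "Suc l \<le> j") (simp_all add: mSuc m_le)
  have "m k \<in> level L k" for k
  proof (induction k)
    case (Suc k)
    then show ?case using coherentD(1)[OF x(1)] level_conv[of "x (Suc k)" L "Suc k" "m k" k]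
      by (simp add: mSuc)
  qed (simp add: m0 coherentD(1)[OF x(1)])
  moreover have "push (apply_subst g) (m k) = m (f k)" if "branch_subst L k f g" for k f g
    using that
  proof (induction k)
    case 0
    then show ?case using coherentD(2)[OF x(1) 0] by (simp add: m0 branch_subst_def)
  next
    case (Suc k)
    have fx: "push (apply_subst g) (x (Suc k)) = x (f (Suc k))" using coherentD(2)[OF x(1)] Suc by blast
    have f: "f (Suc k) = f k \<or> f (Suc k) = Suc (f k)" using Suc.prems by (auto simp: branch_subst_def)
    show ?case
    proof (cases "Suc k \<le> j")
      case True
      then show ?thesis using fx branch_subst_le_self[OF Suc.prems] m_le by (simp add: mSuc)
    next
      case False
      have "push (apply_subst g) (m k) = m (f k)" using Suc branch_subst_Suc by blast
      then have "push (apply_subst g) (m (Suc k)) = x (f (Suc k)) \<star> m (f k)"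
        using False fx by (simp add: mSuc push_subst_conv)
      then show ?thesis using f m_abs m_step by auto
    qed
  qed
  ultimately have m: "m \<in> coherent L" by (simp add: coherent_def)
  define Q where "Q = coherent L \<inter> {v. \<forall>i\<in>{..j}. v i = x i}"
  have "m \<in> Q" using m m_le by (auto simp: Q_def)
  moreover have "pconv v w \<in> Q" if "v \<in> Q" "w \<in> Q" for v w
    using that coherent_pconv idem by (auto simp: Q_def pconv_def)
  moreover have "closed Q" unfolding Q_def
    by (intro closed_Int closed_coherent) (auto simp: Ball_def intro!: closed_Collect_all closed_Collect_imp
        closed_Collect_eq continuous_on_product_coordinates continuous_on_const open_Collect_const)
  ultimately obtain v where v: "v \<in> Q" "pconv (pconv v m) (pconv v m) = pconv v m"
    using pconv_idempotent[of Q m] Q_def by blast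
  define x' where "x' = pconv v m"
  have x'_le: "x' i = x i" if "i \<le> j" for i
    using v(1) that idem by (auto simp: x'_def pconv_def Q_def m_le)
  have x'_j: "x' k \<star> x j = x' k" if "j \<le> k" for k
    using m_j[OF that] by (simp add: x'_def pconv_def conv_assoc)
  have "x' k \<star> x' i = x' k" if "i < Suc j" "i \<le> k" for i k
  proof (cases "k \<le> j")
    case True
    then show ?thesis using that abs idem x'_le by (cases "i = j") auto
  next
    \<comment> \<open>For \<open>k > j\<close> the coordinate \<open>x' k\<close> absorbs
      \<open>x j\<close>, and \<open>x j\<close> absorbs the earlier \<open>x i\<close>.\<close>
    case False
    then have "x' k \<star> x i = x' k \<star> (x j \<star> x i)" using x'_j[of k] by (simp flip: conv_assoc)
    also have "\<dots> = x' k \<star> x j" using abs[of i j] idem that by (cases "i = j") auto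
    finally show ?thesis using x'_j x'_le that False by simp
  qed
  moreover have "x' \<in> coherent L" using v(1) m coherent_pconv by (auto simp: x'_def Q_def)
  moreover have "pconv x' x' = x'" using v(2) by (simp add: x'_def)
  ultimately show ?case by blast
qed

text \<open>The product \<open>x 0 \<star> ... \<star> x k\<close> ends in \<open>x k\<close>, so it
  absorbs each \<open>x i\<close> with \<open>i \<le> k\<close> on the right, hence also each
  \<open>w i\<close>. On the left, \<open>w i\<close> is an idempotent initial segment of
  \<open>w k\<close>.\<close>

theorem coherent_ordered_ultrafilters:
  obtains w where "w \<in> coherent L"
    "\<And>i k. i \<le> k \<Longrightarrow> k \<le> n \<Longrightarrow> w i \<star> w k = w k"
    "\<And>i k. i \<le> k \<Longrightarrow> k \<le> n \<Longrightarrow> w k \<star> w i = w k"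
proof -
  obtain x where x: "x \<in> coherent L" "pconv x x = x"
    and abs: "\<And>i k. i < Suc n \<Longrightarrow> i \<le> k \<Longrightarrow> x k \<star> x i = x k"
    using coherent_right_absorbing[of L "Suc n"] by blast
  have idem: "x k \<star> x k = x k" for k using fun_cong[OF x(2), of k] by (simp add: pconv_def)
  define w where "w = rec_nat (x 0) (\<lambda>k p. p \<star> x (Suc k))"
  have w0: "w 0 = x 0" and wSuc: "w (Suc k) = w k \<star> x (Suc k)" for k by (simp_all add: w_def)
  have w_abs: "w k \<star> x k = w k" for k by (cases k) (simp_all add: w0 wSuc idem conv_assoc)
  have "w k \<in> level L k" for k
  proof (induction k)
    case (Suc k)
    then show ?case using coherentD(1)[OF x(1)] level_conv[of "w k" L k "x (Suc k)" "Suc k"]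
      by (simp add: wSuc)
  qed (simp add: w0 coherentD(1)[OF x(1)])
  moreover have "push (apply_subst g) (w k) = w (f k)" if "branch_subst L k f g" for k f g
    using that
  proof (induction k)
    case 0
    then show ?case using coherentD(2)[OF x(1) 0] by (simp add: w0 branch_subst_def)
  next
    case (Suc k)
    have "push (apply_subst g) (w (Suc k)) = w (f k) \<star> x (f (Suc k))"
      using Suc branch_subst_Suc coherentD(2)[OF x(1)] by (metis push_subst_conv wSuc)
    moreover have "f (Suc k) = f k \<or> f (Suc k) = Suc (f k)"
      using Suc.prems by (auto simp: branch_subst_def)
    ultimately show ?case using w_abs wSuc by auto
  qed
  ultimately have coh: "w \<in> coherent L" by (simp add: coherent_def)
  have wx: "w k \<star> x i = w k" if "i \<le> k" "k \<le> n" for i k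
  proof -
    have "w k \<star> x i = w k \<star> (x k \<star> x i)" by (simp add: w_abs flip: conv_assoc)
    then show ?thesis using abs[of i k] that w_abs by simp
  qed
  have right: "w k \<star> w i = w k" if "i \<le> k" "k \<le> n" for i k
    using that
  proof (induction i)
    case (Suc i)
    then show ?case using wx[of "Suc i" k] by (simp add: wSuc flip: conv_assoc)
  qed (simp add: w0 wx)
  have left: "w i \<star> w k = w k" if "i \<le> k" "k \<le> n" for i k
    using that
  proof (induction k rule: dec_induct)
    case base
    then show ?case using right by simp
  next
    case (step k)
    then show ?case by (simp add: wSuc flip: conv_assoc)
  qed
  show thesis using that coh left right by blast
qed

section \<open>Rooted trees\<close>

locale rooted_tree =
  fixes T :: "'a set" and r :: 'a and parent :: "'a \<Rightarrow> 'a"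
  assumes tree: "finite_rooted_tree T r parent"
begin

definition depth :: "'a \<Rightarrow> nat" where
  "depth t = (LEAST k. (parent ^^ k) t = r)"

text \<open>The node at depth \<open>i\<close> on the branch from the root to \<open>t\<close>;
  truncated subtraction gives the default \<open>t\<close> when \<open>i\<close> exceeds the depth
  of \<open>t\<close>.\<close>

definition anc :: "'a \<Rightarrow> nat \<Rightarrow> 'a" where
  "anc t i = (parent ^^ (depth t - i)) t"

abbreviation leq :: "'a \<Rightarrow> 'a \<Rightarrow> bool" (infix "\<preceq>" 50) where
  "s \<preceq> t \<equiv> (s, t) \<in> tree_order T r parent"

definition comparable :: "'a \<Rightarrow> 'a \<Rightarrow> bool" where
  "comparable s t \<longleftrightarrow> s \<preceq> t \<or> t \<preceq> s"

definition lower :: "'a \<Rightarrow> 'a \<Rightarrow> 'a" where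
  "lower s t = (if s \<preceq> t then s else t)"

lemma finite_T: "finite T"
  and root_in_T: "r \<in> T"
  and parent_in_T: "t \<in> T \<Longrightarrow> t \<noteq> r \<Longrightarrow> parent t \<in> T"
  and reaches_root: "t \<in> T \<Longrightarrow> (t, r) \<in> (parent_rel T r parent)\<^sup>*"
  using tree by (auto simp: finite_rooted_tree_def)

lemma depth_root [simp]: "depth r = 0"
  unfolding depth_def by (rule Least_eq_0) simp

lemma ex_parent_power:
  assumes "t \<in> T"
  shows "\<exists>k. (parent ^^ k) t = r"
  using reaches_root[OF assms]
proof (induction rule: converse_rtrancl_induct)
  case base
  then show ?case by (intro exI[of _ 0]) simp
next
  case (step s t)
  then obtain k where "(parent ^^ k) (parent s) = r" by (auto simp: parent_rel_def)
  then show ?case by (intro exI[of _ "Suc k"]) (simp only: funpow_Suc_right o_apply)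
qed

lemma depth_parent:
  assumes "t \<in> T" "t \<noteq> r"
  shows "depth t = Suc (depth (parent t))"
proof -
  obtain k where "(parent ^^ k) t = r" using ex_parent_power[OF assms(1)] by blast
  then have "(LEAST k. (parent ^^ k) t = r) = Suc (LEAST k. (parent ^^ Suc k) t = r)"
    using assms by (intro Least_Suc) auto
  moreover have "(parent ^^ Suc k) t = (parent ^^ k) (parent t)" for k
    by (simp only: funpow_Suc_right o_apply)
  ultimately show ?thesis by (simp only: depth_def)
qed

lemma depth_eq_0: "t \<in> T \<Longrightarrow> depth t = 0 \<longleftrightarrow> t = r"
  using depth_parent by fastforce

lemma parent_power:
  assumes "t \<in> T" "k \<le> depth t"
  shows "(parent ^^ k) t \<in> T \<and> depth ((parent ^^ k) t) = depth t - k \<and>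
    (t, (parent ^^ k) t) \<in> (parent_rel T r parent)\<^sup>*"
  using assms(2)
proof (induction k)
  case 0
  then show ?case using assms(1) by simp
next
  case (Suc k)
  let ?s = "(parent ^^ k) t"
  have s: "?s \<in> T" "depth ?s = depth t - k" "(t, ?s) \<in> (parent_rel T r parent)\<^sup>*"
    using Suc by auto
  then have "depth ?s \<noteq> 0" using Suc.prems by simp
  then have "?s \<noteq> r" using depth_root by metis
  then have "(?s, parent ?s) \<in> parent_rel T r parent" "parent ?s \<in> T" "depth t - k = Suc (depth (parent ?s))"
    using s depth_parent parent_in_T by (auto simp: parent_rel_def)
  then show ?case using s Suc.prems by (auto intro: rtrancl_into_rtrancl)
qed

lemma anc_depth [simp]: "anc t (depth t) = t"
  by (simp add: anc_def)

lemma anc_in_T: "t \<in> T \<Longrightarrow> anc t i \<in> T"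
  and depth_anc: "t \<in> T \<Longrightarrow> i \<le> depth t \<Longrightarrow> depth (anc t i) = i"
  and leq_anc: "t \<in> T \<Longrightarrow> t \<preceq> anc t i"
  using parent_power[of t "depth t - i"] by (auto simp: anc_def tree_order_def)

lemma anc_0: "t \<in> T \<Longrightarrow> anc t 0 = r"
  using depth_anc[of t 0] depth_eq_0[OF anc_in_T] by simp

lemma anc_Suc:
  assumes "Suc i \<le> depth t"
  shows "anc t i = parent (anc t (Suc i))"
proof -
  have "depth t - i = Suc (depth t - Suc i)" using assms by simp
  then show ?thesis by (simp add: anc_def)
qed

text \<open>Each parent step lowers the depth by exactly one, so a node above \<open>s\<close> is
  determined by its depth.\<close>

lemma leqD:
  assumes "s \<preceq> t"
  shows "s \<in> T" "t \<in> T" "depth t \<le> depth s" "anc s (depth t) = t"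
proof -
  show s: "s \<in> T" and "t \<in> T" using assms by (auto simp: tree_order_def)
  have "(s, t) \<in> (parent_rel T r parent)\<^sup>*" using assms by (auto simp: tree_order_def)
  then have "depth t \<le> depth s \<and> anc s (depth t) = t"
  proof (induction rule: converse_rtrancl_induct)
    case (step s s')
    then have s: "s' = parent s" "s \<in> T" "s \<noteq> r" by (auto simp: parent_rel_def)
    then have d: "depth s = Suc (depth s')" using depth_parent by simp
    then have "depth s - depth t = Suc (depth s' - depth t)"
      using step by (simp add: Suc_diff_le)
    then have "anc s (depth t) = anc s' (depth t)"
      unfolding anc_def s(1) by (simp only: funpow_Suc_right o_apply)
    then show ?case using step d by simp
  qed simp
  then show "depth t \<le> depth s" "anc s (depth t) = t" by auto
qed

lemma anc_leq:
  assumes "s \<preceq> t" "i \<le> depth t"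
  shows "anc s i = anc t i"
proof -
  have "anc t i = (parent ^^ (depth t - i)) ((parent ^^ (depth s - depth t)) s)"
    using leqD(4)[OF assms(1)] by (simp add: anc_def)
  also have "\<dots> = (parent ^^ (depth t - i + (depth s - depth t))) s" by (simp add: funpow_add)
  also have "depth t - i + (depth s - depth t) = depth s - i" using leqD(3)[OF assms(1)] assms(2) by simp
  finally show ?thesis by (simp add: anc_def)
qed

lemma leq_refl: "t \<in> T \<Longrightarrow> t \<preceq> t"
  by (simp add: tree_order_def)

lemma leq_trans: "s \<preceq> t \<Longrightarrow> t \<preceq> u \<Longrightarrow> s \<preceq> u"
  by (auto simp: tree_order_def)

lemma leq_antisym:
  assumes "s \<preceq> t" "t \<preceq> s"
  shows "s = t"
proof -
  have "depth s = depth t" using leqD(3)[OF assms(1)] leqD(3)[OF assms(2)] by simp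
  then show ?thesis using leqD(4)[OF assms(1)] anc_depth[of s] by metis
qed

lemma leq_root: "t \<in> T \<Longrightarrow> t \<preceq> r"
  using reaches_root root_in_T by (simp add: tree_order_def)

text \<open>All nodes above \<open>s\<close> lie on the single branch from \<open>s\<close> to the
  root.\<close>

lemma comparable_above:
  assumes "s \<preceq> t" "s \<preceq> t'"
  shows "comparable t t'"
proof -
  have *: "u \<preceq> u'" if "s \<preceq> u" "s \<preceq> u'" "depth u' \<le> depth u" for u u'
    using anc_leq[OF that(1,3)] leqD(4)[OF that(2)] leq_anc[of u "depth u'"] leqD(2)[OF that(1)] by simp
  show ?thesis using *[of t t'] *[of t' t] assms by (cases "depth t \<le> depth t'") (auto simp: comparable_def)
qed

lemma lower_leq: "comparable s t \<Longrightarrow> lower s t \<preceq> s \<and> lower s t \<preceq> t"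
  unfolding comparable_def lower_def by (auto intro: leq_refl dest: leqD(1))

lemma lower_eqI: "m \<preceq> s \<Longrightarrow> m \<preceq> t \<Longrightarrow> m = s \<or> m = t \<Longrightarrow> lower s t = m"
  unfolding lower_def by (auto dest: leq_antisym)

text \<open>Both sides are the least element of the chain \<open>{e, e', t}\<close>.\<close>

lemma lower_lower:
  assumes "comparable e t" "comparable e' (lower e t)"
  shows "comparable e e'" "comparable (lower e e') t" "lower (lower e e') t = lower e' (lower e t)"
proof -
  define m where "m = lower e t"
  define l where "l = lower e' m"
  have m: "m \<preceq> e" "m \<preceq> t" "m = e \<or> m = t"
    using lower_leq[OF assms(1)] by (auto simp: m_def lower_def)
  have l: "l \<preceq> e'" "l \<preceq> m" "l = e' \<or> l = m"
    using lower_leq[OF assms(2)] by (auto simp: l_def m_def lower_def)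
  have le: "l \<preceq> e" and lt: "l \<preceq> t" using leq_trans[OF l(2)] m by blast+
  show "comparable e e'" using comparable_above[OF le l(1)] .
  have ee': "lower e e' = e \<or> lower e e' = e'" by (simp add: lower_def)
  then show "comparable (lower e e') t"
    using comparable_above[OF le lt] comparable_above[OF l(1) lt] by metis
  have "l \<preceq> lower e e'" using ee' le l(1) by metis
  moreover have "l = lower e e' \<or> l = t"
    using lower_eqI[OF le l(1)] l(3) m(3) by metis
  ultimately show "lower (lower e e') t = lower e' (lower e t)"
    using lower_eqI[OF _ lt] unfolding l_def m_def by blast
qed

end

section \<open>Ultrafilters of tree words\<close>

locale tree_ultrafilters = rooted_tree T r parent
  for T :: "'a set" and r :: 'a and parent :: "'a \<Rightarrow> 'a" +
  fixes L :: "'a set" and u :: "nat \<Rightarrow> ('a + nat) list set \<Rightarrow> bool"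
  assumes disjoint: "(T - {r}) \<inter> L = {}"
    and coherent: "u \<in> coherent L"
    and absorb: "\<And>t i. t \<in> T \<Longrightarrow> i \<le> depth t \<Longrightarrow> u i \<star> u (depth t) = u (depth t) \<and> u (depth t) \<star> u i = u (depth t)"
begin

definition relabel :: "'a \<Rightarrow> ('a + nat) list \<Rightarrow> 'a list" where
  "relabel t = map (case_sum id (anc t))"

text \<open>Nodes of equal depth share one linear ultrafilter, renamed along their branches.\<close>

definition U :: "'a \<Rightarrow> 'a list set \<Rightarrow> bool" where
  "U t = push (relabel t) (u (depth t))"

lemma ultra_u: "ultra (u k)" and u_branch_words: "u k (branch_words L k d)"
  using levelD[OF coherentD(1)[OF coherent]] by auto

lemma ultra_U: "ultra (U t)"
  unfolding U_def by (intro ultra_push ultra_u)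

lemma set_branch_words: "w \<in> branch_words L k d \<Longrightarrow> c \<in> set w \<Longrightarrow>
    (\<exists>a\<in>L. c = Inl a) \<or> (\<exists>i\<in>{1..k}. c = Inr i)"
  by (auto simp: branch_words_def)

text \<open>The branch of \<open>s\<close> is an initial part of that of \<open>t\<close>, so
  \<open>relabel t\<close> serves for both ultrafilters and, respecting concatenation, carries over
  the absorption laws of \<open>u\<close>.\<close>

lemma U_conv:
  assumes "t \<preceq> s"
  shows "U s \<star> U t = U t" "U t \<star> U s = U t"
proof -
  note D = leqD[OF assms]
  have "U s = push (relabel t) (u (depth s))" unfolding U_def
  proof (rule push_cong[OF ultra_u u_branch_words])
    fix w assume "w \<in> branch_words L (depth s) 0"
    then show "relabel s w = relabel t w"
      unfolding relabel_def by (auto dest!: set_branch_words simp: anc_leq[OF assms])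
  qed
  moreover have "relabel t (x @ y) = relabel t x @ relabel t y" for x y by (simp add: relabel_def)
  ultimately show "U s \<star> U t = U t" "U t \<star> U s = U t"
    using absorb[OF D(1,3)] unfolding U_def by (simp_all flip: push_conv)
qed

lemma U_lower: "comparable s t \<Longrightarrow> U s \<star> U t = U (lower s t)"
  unfolding comparable_def lower_def by (auto simp: U_conv)

text \<open>With every variable occurring at least once, the variables of the renamed word are
  exactly the non-root nodes on the branch of \<open>t\<close>.\<close>

lemma relabel_tree_words_at:
  assumes t: "t \<in> T" and w: "w \<in> branch_words L (depth t) 1"
  shows "relabel t w \<in> tree_words_at T r parent L t"
proof -
  have anc: "anc t i \<in> T - {r}" if "i \<in> {1..depth t}" for i
    using anc_in_T[OF t] depth_anc[OF t, of i] that by (metis Diff_iff atLeastAtMost_iff depth_root empty_iff insert_iff not_one_le_zero)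
  have sub: "set (relabel t w) \<subseteq> L \<union> anc t ` {1..depth t}"
    using set_branch_words[OF w] by (fastforce simp: relabel_def)
  show ?thesis
  proof (cases "t = r")
    case True
    then show ?thesis using sub by (auto simp: tree_words_at_def)
  next
    case False
    have occ: "anc t i \<in> set (relabel t w)" if "i \<in> {1..depth t}" for i
    proof -
      have "1 \<le> count_list w (Inr i)" using w that by (auto simp: branch_words_def)
      then have "Inr i \<in> set w" using count_list_0_iff[of w "Inr i"] by auto
      then show ?thesis by (force simp: relabel_def)
    qed
    have vars: "set (relabel t w) \<inter> (T - {r}) = anc t ` {1..depth t}"
    proof
      show "set (relabel t w) \<inter> (T - {r}) \<subseteq> anc t ` {1..depth t}" using sub disjoint by blast
      show "anc t ` {1..depth t} \<subseteq> set (relabel t w) \<inter> (T - {r})"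
        by (intro image_subsetI IntI occ anc)
    qed
    have "1 \<le> depth t" using depth_eq_0[OF t] False by simp
    then have "t \<in> anc t ` {1..depth t}" by (intro image_eqI[of _ _ "depth t"]) auto
    moreover have "anc t ` {1..depth t} \<in> Chains (tree_order T r parent)"
      using comparable_above[OF leq_anc leq_anc, OF t t] by (auto simp: Chains_def comparable_def)
    ultimately have "chain_with_least T r parent (set (relabel t w) \<inter> (T - {r})) t"
      unfolding chain_with_least_def vars using leq_anc[OF t] by blast
    moreover have "relabel t w \<in> tree_words T r L"
    proof -
      have "anc t ` {1..depth t} \<subseteq> T - {r}" by (intro image_subsetI anc)
      then have "set (relabel t w) \<subseteq> L \<union> (T - {r})" using sub by blast
      then show ?thesis by (simp add: tree_words_def lists_eq_set)
    qed
    ultimately show ?thesis using False by (simp add: tree_words_at_def)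
  qed
qed

lemma U_tree_words_at: "t \<in> T \<Longrightarrow> U t (tree_words_at T r parent L t)"
  unfolding U_def push_def
  by (rule ultra_mono[OF ultra_u u_branch_words]) (auto intro: relabel_tree_words_at)

lemma branch_words_length:
  assumes "w \<in> branch_words L k d" "1 \<le> k"
  shows "d \<le> length w"
proof -
  have "d \<le> count_list w (Inr 1)" using assms by (simp add: branch_words_def)
  then show ?thesis using count_le_length[of w "Inr 1"] by simp
qed

text \<open>For \<open>t \<noteq> r\<close> many occurrences of the first variable force length. At
  the root there is no variable to count, but \<open>u 0\<close> is the image of \<open>u 1\<close>
  under the substitution of a letter, which preserves length.\<close>

lemma U_length:
  assumes "t \<in> T" "t \<noteq> r \<or> L \<noteq> {}"
  shows "U t {w. d \<le> length w}"
proof -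
  have "u (depth t) {w. d \<le> length w}"
  proof (cases "t = r")
    case False
    then have "1 \<le> depth t" using depth_eq_0[OF assms(1)] by simp
    then show ?thesis
      by (intro ultra_mono[OF ultra_u u_branch_words]) (auto intro: branch_words_length)
  next
    case True
    then obtain a where "a \<in> L" using assms by blast
    then have "branch_subst L 1 (\<lambda>_. 0) (\<lambda>_. Inl a)" by (simp add: branch_subst_def)
    then have "u 0 = push (apply_subst (\<lambda>_. Inl a)) (u 1)" using coherentD(2)[OF coherent] by metis
    moreover have "u 1 {w. d \<le> length w}"
    proof (rule ultra_mono[OF ultra_u u_branch_words])
      show "branch_words L 1 d \<subseteq> {w. d \<le> length w}"
        by (auto intro: branch_words_length)
    qed
    ultimately show ?thesis using True by (simp add: push_def apply_subst_def)
  qed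
  then show ?thesis by (simp add: U_def push_def relabel_def)
qed

lemma induced_map_in_T: "induced_map T r \<sigma> t \<in> T"
  using root_in_T by (simp add: induced_map_def)

text \<open>On the branch of \<open>t\<close> the substitution acts linearly, with
  \<open>\<phi>\<close> the depths of the image nodes and \<open>g\<close> the new symbols, so
  coherence of \<open>u\<close> determines the image.\<close>

lemma U_subst:
  assumes \<sigma>: "var_subst T r parent L \<sigma>" and t: "t \<in> T"
  shows "push (map \<sigma>) (U t) = U (induced_map T r \<sigma> t)"
proof -
  define f where "f = induced_map T r \<sigma>"
  define k where "k = depth t"
  define \<phi> where "\<phi> i = depth (f (anc t i))" for i
  define g where "g i = (if \<phi> i = 0 then Inl (\<sigma> (anc t i)) else Inr (\<phi> i) :: 'a + nat)" for i
  have hom: "regressive_hom T r parent f" using \<sigma> by (simp add: var_subst_def f_def)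
  have fT: "f s \<in> T" for s by (simp add: f_def induced_map_in_T)
  have mono: "f s \<preceq> f s'" if "s \<preceq> s'" for s s' using hom that by (auto simp: regressive_hom_def)
  \<comment> \<open>By order preservation the images of the branch nodes lie above
    \<open>f t\<close>, where depth identifies a node.\<close>
  have f_anc: "f (anc t i) = anc (f t) (\<phi> i)" for i
    using leqD(4)[OF mono[OF leq_anc[OF t]]] by (simp add: \<phi>_def)
  have anc_T: "anc t i \<in> T - {r}" if "i \<in> {1..k}" for i
    using anc_in_T[OF t] depth_anc[OF t, of i] that
    by (metis Diff_iff atLeastAtMost_iff depth_root empty_iff insert_iff k_def not_one_le_zero)
  have sub: "branch_subst L k \<phi> g"
    unfolding branch_subst_def
  proof (intro conjI allI impI ballI)
    show "\<phi> 0 = 0" by (simp add: \<phi>_def f_def induced_map_def anc_0[OF t])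
  next
    fix i assume i: "i < k"
    then have p: "anc t i = parent (anc t (Suc i))" using anc_Suc[of i t] by (simp add: k_def)
    have "anc t (Suc i) \<in> T - {r}" using anc_T i by simp
    then have "adjacent T r parent (anc t (Suc i)) (anc t i)"
      by (auto simp: adjacent_def parent_rel_def p)
    then have "f (anc t (Suc i)) = f (anc t i) \<or> adjacent T r parent (f (anc t (Suc i))) (f (anc t i))"
      using hom by (auto simp: regressive_hom_def)
    \<comment> \<open>Adjacency alone would let the depth drop by one; order preservation excludes
      this.\<close>
    moreover have "anc t (Suc i) \<preceq> anc t i"
      using leq_anc[OF anc_in_T[OF t], of "Suc i" i] anc_leq[OF leq_anc[OF t, of "Suc i"], of i]
        depth_anc[OF t, of "Suc i"] i by (simp add: k_def)
    then have "\<phi> i \<le> \<phi> (Suc i)" using leqD(3)[OF mono] by (simp add: \<phi>_def)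
    ultimately show "\<phi> (Suc i) = \<phi> i \<or> \<phi> (Suc i) = Suc (\<phi> i)"
      unfolding \<phi>_def adjacent_def parent_rel_def using depth_parent by fastforce
  next
    fix i assume i: "i \<in> {1..k}"
    have "\<sigma> (anc t i) \<in> L" if "\<phi> i = 0"
    proof -
      have "f (anc t i) = r" using that depth_eq_0[OF fT] by (simp add: \<phi>_def)
      then have "\<sigma> (anc t i) \<notin> T - {r}" using anc_T[OF i] by (auto simp: f_def induced_map_def split: if_splits)
      moreover have "\<sigma> (anc t i) \<in> (T - {r}) \<union> L"
        using \<sigma> anc_T[OF i] unfolding var_subst_def by (metis (no_types) PiE UnI1)
      ultimately show ?thesis by blast
    qed
    then show "g i \<in> (if \<phi> i = 0 then Inl ` L else {Inr (\<phi> i)})" by (simp add: g_def)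
  qed
  have \<phi>k: "\<phi> k = depth (f t)" by (simp add: \<phi>_def k_def)
  have "push (map \<sigma>) (U t) = push (map \<sigma> \<circ> relabel t) (u k)" by (simp add: U_def push_push k_def)
  also have "\<dots> = push (relabel (f t) \<circ> apply_subst g) (u k)"
  proof (rule push_cong[OF ultra_u u_branch_words])
    fix w assume w: "w \<in> branch_words L k 0"
    have "\<sigma> (case_sum id (anc t) c) = case_sum id (anc (f t)) (case_sum Inl g c)" if c: "c \<in> set w" for c
      using set_branch_words[OF w c]
    proof (elim disjE bexE)
      fix a assume "a \<in> L" "c = Inl a"
      then show ?thesis using \<sigma> by (simp add: var_subst_def)
    next
      fix i assume i: "i \<in> {1..k}" and [simp]: "c = Inr i"
      show ?thesis
      proof (cases "\<phi> i = 0")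
        case False
        then have "f (anc t i) \<noteq> r" by (auto simp: \<phi>_def)
        then have "f (anc t i) = \<sigma> (anc t i)" by (auto simp: f_def induced_map_def split: if_splits)
        then show ?thesis using False by (simp add: g_def f_anc)
      qed (simp add: g_def)
    qed
    then show "(map \<sigma> \<circ> relabel t) w = (relabel (f t) \<circ> apply_subst g) w"
      by (simp add: relabel_def apply_subst_def)
  qed
  also have "\<dots> = push (relabel (f t)) (push (apply_subst g) (u k))" by (simp add: push_push)
  also have "\<dots> = U (f t)" using coherentD(2)[OF coherent sub] by (simp add: U_def \<phi>k)
  finally show ?thesis by (simp add: f_def)
qed

end

section \<open>Choice of the words and the Ramsey statement\<close>

context tree_ultrafilters
begin

text \<open>\<open>D\<close> collects pairs \<open>(x, t)\<close> of a concatenation \<open>x\<close> built so far and the least element \<open>t\<close>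
  of its chain. It starts from \<open>([], r)\<close>, so the empty word is never required to have a colour.\<close>

lemma select_words:
  fixes F :: "nat \<Rightarrow> ('a \<Rightarrow> 'a) set" and c :: "'a list \<Rightarrow> 'c" and d :: "nat \<Rightarrow> nat"
  assumes F: "\<And>n. finite (F n)" "\<And>n \<sigma>. \<sigma> \<in> F n \<Longrightarrow> var_subst T r parent L \<sigma>"
    and colour: "\<And>t. t \<in> T \<Longrightarrow> U t {w. c w = colour t}"
  obtains b :: "nat \<Rightarrow> 'a \<Rightarrow> 'a list" and D :: "nat \<Rightarrow> ('a list \<times> 'a) set" where
    "\<And>n t. t \<in> T \<Longrightarrow> b n t \<in> tree_words_at T r parent L t"
    "\<And>n t. t \<in> T \<Longrightarrow> t \<noteq> r \<or> L \<noteq> {} \<Longrightarrow> d n \<le> length (b n t)"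
    "([], r) \<in> D 0" "\<And>n. D n \<subseteq> D (Suc n)"
    "\<And>n x t s \<sigma>. (x, t) \<in> D n \<Longrightarrow> s \<in> T \<Longrightarrow> \<sigma> \<in> F n \<Longrightarrow> comparable (induced_map T r \<sigma> s) t \<Longrightarrow>
       c (x @ map \<sigma> (b n s)) = colour (lower (induced_map T r \<sigma> s) t) \<and>
       (x @ map \<sigma> (b n s), lower (induced_map T r \<sigma> s) t) \<in> D (Suc n)"
proof -
  \<comment> \<open>The invariant of the construction: whichever comparable node comes next, almost
    every continuation of \<open>x\<close> gets the right colour.\<close>
  define good where "good x t \<longleftrightarrow> t \<in> T \<and>
    (\<forall>s\<in>{s \<in> T. comparable s t}. U s {y. c (x @ y) = colour (lower s t)})" for x t
  have extend: "U e {y. c (x @ y) = colour (lower e t) \<and> good (x @ y) (lower e t)}"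
    if e: "e \<in> T" "comparable e t" and x: "good x t" for e x t
  proof -
    define m where "m = lower e t"
    have m: "m \<in> T" using e x by (auto simp: m_def lower_def good_def)
    have now: "U e {y. c (x @ y) = colour m}" using x e by (auto simp: good_def m_def)
    \<comment> \<open>As \<open>U e \<star> U e' = U (lower e e')\<close>, what
      \<open>good x t\<close> says at \<open>lower e e'\<close> can be read as a condition on
      \<open>y\<close> chosen first and \<open>z\<close> afterwards.\<close>
    have "U e {y. \<forall>e'\<in>{e' \<in> T. comparable e' m}. U e' {z. c ((x @ y) @ z) = colour (lower e' m)}}"
    proof (rule ultra_Ball[OF ultra_U])
      show "finite {e' \<in> T. comparable e' m}" using finite_T by simp
      fix e' assume e': "e' \<in> {e' \<in> T. comparable e' m}"
      have ll: "comparable e e'" "comparable (lower e e') t" "lower (lower e e') t = lower e' m"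
        using lower_lower[OF e(2), of e'] e' by (auto simp: m_def)
      have "lower e e' \<in> T" using e e' by (auto simp: lower_def)
      then have "U (lower e e') {y. c (x @ y) = colour (lower e' m)}"
        using x ll(2,3) unfolding good_def by fastforce
      then have "(U e \<star> U e') {y. c (x @ y) = colour (lower e' m)}" by (simp add: U_lower[OF ll(1)])
      then show "U e {y. U e' {z. c ((x @ y) @ z) = colour (lower e' m)}}" by (simp add: conv_def)
    qed
    then have "U e ({y. c (x @ y) = colour m} \<inter>
        {y. \<forall>e'\<in>{e' \<in> T. comparable e' m}. U e' {z. c ((x @ y) @ z) = colour (lower e' m)}})"
      using now unfolding ultra_Int[OF ultra_U] by blast
    then show ?thesis
      unfolding m_def[symmetric] by (rule ultra_mono[OF ultra_U]) (auto simp: good_def m)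
  qed
  define allowed where "allowed n s b \<longleftrightarrow> b \<in> tree_words_at T r parent L s \<and>
    (s \<noteq> r \<or> L \<noteq> {} \<longrightarrow> d n \<le> length b)" for n s b
  define ext where "ext n b D = D \<union> (\<lambda>((x, t), s, \<sigma>). (x @ map \<sigma> (b s), lower (induced_map T r \<sigma> s) t)) `
      {((x, t), s, \<sigma>). (x, t) \<in> D \<and> s \<in> T \<and> \<sigma> \<in> F n \<and> comparable (induced_map T r \<sigma> s) t}"
    for n b and D :: "('a list \<times> 'a) set"
  define P where "P n S \<longleftrightarrow> finite (snd S) \<and> (\<forall>(x, t)\<in>snd S. good x t) \<and> (n = 0 \<longrightarrow> ([], r) \<in> snd S)"
    for n :: nat and S :: "('a \<Rightarrow> 'a list) \<times> ('a list \<times> 'a) set"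
  define Q where "Q n S S' \<longleftrightarrow> snd S' = ext n (fst S') (snd S) \<and>
      (\<forall>s\<in>T. allowed n s (fst S' s)) \<and>
      (\<forall>(x, t)\<in>snd S. \<forall>s\<in>T. \<forall>\<sigma>\<in>F n. comparable (induced_map T r \<sigma> s) t \<longrightarrow>
        c (x @ map \<sigma> (fst S' s)) = colour (lower (induced_map T r \<sigma> s) t))"
    for n and S S' :: "('a \<Rightarrow> 'a list) \<times> ('a list \<times> 'a) set"
  have "\<exists>f. \<forall>n. P n (f n) \<and> Q n (f n) (f (Suc n))"
  proof (rule dependent_nat_choice)
    have "good [] r" using colour root_in_T leq_root by (auto simp: good_def lower_def)
    \<comment> \<open>The words of stage \<open>n\<close> are stored in state \<open>Suc n\<close>,
      so the initial state holds only a placeholder for them.\<close>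
    then show "\<exists>S. P 0 S" by (intro exI[of _ "(undefined, {([], r)})"]) (simp add: P_def)
  next
    fix S n assume S: "P n S"
    define ok where "ok s b \<longleftrightarrow> allowed n s b \<and> (\<forall>(x, t)\<in>snd S. \<forall>\<sigma>\<in>F n. comparable (induced_map T r \<sigma> s) t \<longrightarrow>
      c (x @ map \<sigma> b) = colour (lower (induced_map T r \<sigma> s) t) \<and>
      good (x @ map \<sigma> b) (lower (induced_map T r \<sigma> s) t))" for s b
    have "\<exists>b. ok s b" if s: "s \<in> T" for s
    proof -
      let ?I = "{((x, t), \<sigma>). (x, t) \<in> snd S \<and> \<sigma> \<in> F n \<and> comparable (induced_map T r \<sigma> s) t}"
      have fin: "finite ?I"
        by (rule finite_subset[of _ "snd S \<times> F n"]) (use S F in \<open>auto simp: P_def\<close>)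
      \<comment> \<open>One word for \<open>s\<close> must meet finitely many requirements;
        \<open>U_subst\<close> turns each into a condition on the ultrafilter of the image node,
        where \<open>extend\<close> applies.\<close>
      have "U s {b. \<forall>i\<in>?I. case i of ((x, t), \<sigma>) \<Rightarrow>
          c (x @ map \<sigma> b) = colour (lower (induced_map T r \<sigma> s) t) \<and>
          good (x @ map \<sigma> b) (lower (induced_map T r \<sigma> s) t)}"
      proof (rule ultra_Ball[OF ultra_U fin], clarify)
        fix x t \<sigma> assume i: "(x, t) \<in> snd S" "\<sigma> \<in> F n" "comparable (induced_map T r \<sigma> s) t"
        have "good x t" using S i(1) by (auto simp: P_def)
        from extend[OF induced_map_in_T i(3) this]
        have "push (map \<sigma>) (U s) {y. c (x @ y) = colour (lower (induced_map T r \<sigma> s) t) \<and>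
            good (x @ y) (lower (induced_map T r \<sigma> s) t)}"
          unfolding U_subst[OF F(2)[OF i(2)] s] .
        then show "U s {b. c (x @ map \<sigma> b) = colour (lower (induced_map T r \<sigma> s) t) \<and>
            good (x @ map \<sigma> b) (lower (induced_map T r \<sigma> s) t)}"
          by (simp add: push_def)
      qed
      moreover have "U s {b. allowed n s b}"
      proof -
        have "U s {w. s \<noteq> r \<or> L \<noteq> {} \<longrightarrow> d n \<le> length w}"
          using U_length[OF s, of "d n"] ultra_UNIV[OF ultra_U] by (cases "s \<noteq> r \<or> L \<noteq> {}") auto
        then have "U s (tree_words_at T r parent L s \<inter> {w. s \<noteq> r \<or> L \<noteq> {} \<longrightarrow> d n \<le> length w})"
          using U_tree_words_at[OF s] unfolding ultra_Int[OF ultra_U] by blast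
        then show ?thesis by (rule ultra_mono[OF ultra_U]) (auto simp: allowed_def)
      qed
      ultimately have "U s ({b. allowed n s b} \<inter> {b. \<forall>i\<in>?I. case i of ((x, t), \<sigma>) \<Rightarrow>
          c (x @ map \<sigma> b) = colour (lower (induced_map T r \<sigma> s) t) \<and>
          good (x @ map \<sigma> b) (lower (induced_map T r \<sigma> s) t)})"
        unfolding ultra_Int[OF ultra_U] by blast
      from ultra_nonempty[OF ultra_U this] show ?thesis by (auto simp: ok_def)
    qed
    then obtain b where b: "\<And>s. s \<in> T \<Longrightarrow> ok s (b s)" by metis
    have ok: "c (x @ map \<sigma> (b s)) = colour (lower (induced_map T r \<sigma> s) t)"
        "good (x @ map \<sigma> (b s)) (lower (induced_map T r \<sigma> s) t)"
      if "(x, t) \<in> snd S" "s \<in> T" "\<sigma> \<in> F n" "comparable (induced_map T r \<sigma> s) t" for x t s \<sigma>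
      using b[OF that(2)] that unfolding ok_def by fast+
    let ?I = "{((x, t), s, \<sigma>). (x, t) \<in> snd S \<and> s \<in> T \<and> \<sigma> \<in> F n \<and> comparable (induced_map T r \<sigma> s) t}"
    have "finite ?I"
      by (rule finite_subset[of _ "snd S \<times> T \<times> F n"]) (use S F finite_T in \<open>auto simp: P_def\<close>)
    then have "finite (ext n b (snd S))" using S by (simp add: ext_def P_def)
    moreover have "good x t" if "(x, t) \<in> ext n b (snd S)" for x t
      using that S ok(2) unfolding ext_def P_def by auto
    ultimately have "P (Suc n) (b, ext n b (snd S))" by (auto simp: P_def)
    moreover have "Q n S (b, ext n b (snd S))"
      using ok(1) b by (auto simp: Q_def) (simp add: ok_def)
    ultimately show "\<exists>S'. P (Suc n) S' \<and> Q n S S'" by blast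
  qed
  then obtain f where f: "\<And>n. P n (f n)" "\<And>n. Q n (f n) (f (Suc n))" by blast
  show thesis
  proof (rule that[of "\<lambda>n. fst (f (Suc n))" "\<lambda>n. snd (f n)"])
    show "([], r) \<in> snd (f 0)" using f(1)[of 0] by (simp add: P_def)
    show "snd (f n) \<subseteq> snd (f (Suc n))" for n using f(2)[of n] by (simp add: Q_def ext_def)
    show "fst (f (Suc n)) t \<in> tree_words_at T r parent L t" if "t \<in> T" for n t
      using f(2)[of n] that by (simp add: Q_def allowed_def)
    show "d n \<le> length (fst (f (Suc n)) t)" if "t \<in> T" "t \<noteq> r \<or> L \<noteq> {}" for n t
      using f(2)[of n] that unfolding Q_def allowed_def by blast
    fix n x t s \<sigma>
    assume *: "(x, t) \<in> snd (f n)" "s \<in> T" "\<sigma> \<in> F n" "comparable (induced_map T r \<sigma> s) t"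
    have "(x @ map \<sigma> (fst (f (Suc n)) s), lower (induced_map T r \<sigma> s) t)
        \<in> ext n (fst (f (Suc n))) (snd (f n))"
      unfolding ext_def by (rule UnI2, rule image_eqI[of _ _ "((x, t), s, \<sigma>)"]) (use * in auto)
    then show "c (x @ map \<sigma> (fst (f (Suc n)) s)) = colour (lower (induced_map T r \<sigma> s) t) \<and>
        (x @ map \<sigma> (fst (f (Suc n)) s), lower (induced_map T r \<sigma> s) t) \<in> snd (f (Suc n))"
      using f(2)[of n] * unfolding Q_def by fastforce
  qed
qed

theorem ramsey:
  fixes F :: "nat \<Rightarrow> ('a \<Rightarrow> 'a) set" and c :: "'a list \<Rightarrow> 'c" and d :: "nat \<Rightarrow> nat"
  assumes c: "finite (c ` tree_words T r L)"
    and F: "\<And>n. finite (F n)" "\<And>n \<sigma>. \<sigma> \<in> F n \<Longrightarrow> var_subst T r parent L \<sigma>"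
  obtains b :: "'a \<Rightarrow> nat \<Rightarrow> 'a list" and colour :: "'a \<Rightarrow> 'c" where
    "\<And>t n. t \<in> T \<Longrightarrow> b t n \<in> tree_words_at T r parent L t"
    "\<And>t n. t \<in> T \<Longrightarrow> t \<noteq> r \<or> L \<noteq> {} \<Longrightarrow> d n \<le> length (b t n)"
    "\<And>(l::nat) n s \<sigma> t. strict_mono_on {..l} n \<Longrightarrow> \<forall>j\<le>l. s j \<in> T \<and> \<sigma> j \<in> F (n j) \<Longrightarrow>
       chain_with_least T r parent ((\<lambda>j. induced_map T r (\<sigma> j) (s j)) ` {..l}) t \<Longrightarrow>
       c (concat (map (\<lambda>j. subst_word (\<sigma> j) (b (s j) (n j))) [0..<Suc l])) = colour t"
proof -
  \<comment> \<open>The colour attached to \<open>t\<close> is the one shared by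
    \<open>U t\<close>-almost all words.\<close>
  have "\<exists>a. U t {w. c w = a}" if t: "t \<in> T" for t
  proof -
    have "tree_words_at T r parent L t \<subseteq> tree_words T r L"
      by (auto simp: tree_words_at_def tree_words_def)
    then have "tree_words_at T r parent L t \<subseteq> (\<Union>a\<in>c ` tree_words T r L. {w. c w = a})" by auto
    with U_tree_words_at[OF t] have "U t (\<Union>a\<in>c ` tree_words T r L. {w. c w = a})"
      by (rule ultra_mono[OF ultra_U])
    then show ?thesis using ultra_finite_Union[OF ultra_U c] by blast
  qed
  then obtain colour where colour: "\<And>t. t \<in> T \<Longrightarrow> U t {w. c w = colour t}" by metis
  obtain b D where b: "\<And>n t. t \<in> T \<Longrightarrow> b n t \<in> tree_words_at T r parent L t"
      "\<And>n t. t \<in> T \<Longrightarrow> t \<noteq> r \<or> L \<noteq> {} \<Longrightarrow> d n \<le> length (b n t)"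
    and D0: "([], r) \<in> D 0" and DSuc: "\<And>n. D n \<subseteq> D (Suc n)"
    and step: "\<And>n x t s \<sigma>. (x, t) \<in> D n \<Longrightarrow> s \<in> T \<Longrightarrow> \<sigma> \<in> F n \<Longrightarrow> comparable (induced_map T r \<sigma> s) t \<Longrightarrow>
       c (x @ map \<sigma> (b n s)) = colour (lower (induced_map T r \<sigma> s) t) \<and>
       (x @ map \<sigma> (b n s), lower (induced_map T r \<sigma> s) t) \<in> D (Suc n)"
    by (rule select_words[where F = F and d = d and c = c and colour = colour, OF F colour]) blast+
  have D_mono: "D m \<subseteq> D n" if "m \<le> n" for m n by (rule lift_Suc_mono_le[of D, OF DSuc that])
  show thesis
  proof (rule that[of "\<lambda>t n. b n t" colour])
    fix l :: nat and n s \<sigma> t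
    assume n: "strict_mono_on {..l} n" and s: "\<forall>j\<le>l. s j \<in> T \<and> \<sigma> j \<in> F (n j)"
      and ch: "chain_with_least T r parent ((\<lambda>j. induced_map T r (\<sigma> j) (s j)) ` {..l}) t"
    define e where "e j = induced_map T r (\<sigma> j) (s j)" for j
    define w where "w j = map (\<sigma> j) (b (n j) (s j))" for j
    have ch: "comparable (e i) (e j)" if "i \<le> l" "j \<le> l" for i j
      using ch that by (auto simp: chain_with_least_def Chains_def comparable_def e_def)
    have least: "t \<in> e ` {..l}" "\<And>i. i \<le> l \<Longrightarrow> t \<preceq> e i"
      using \<open>chain_with_least _ _ _ _ _\<close> by (auto simp: chain_with_least_def e_def)
    \<comment> \<open>Here \<open>m\<close> is the least of the first images; being paired with the
      partial concatenation in \<open>D\<close>, it determines how the next word may be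
      appended.\<close>
    have "\<exists>m \<in> e ` {..j}. (\<forall>i\<le>j. m \<preceq> e i) \<and> c (concat (map w [0..<Suc j])) = colour m \<and>
        (concat (map w [0..<Suc j]), m) \<in> D (Suc (n j))" if "j \<le> l" for j
      using that
    proof (induction j)
      case 0
      have e: "e 0 \<in> T" by (simp add: e_def induced_map_in_T)
      \<comment> \<open>The root is the greatest node, so the initial pair \<open>([], r)\<close>
        can be followed by any node.\<close>
      then have "lower (e 0) r = e 0" "comparable (e 0) r"
        using leq_root by (auto simp: lower_def comparable_def)
      then show ?case
        using step[of "[]" r "n 0" "s 0" "\<sigma> 0"] D_mono[of 0 "n 0"] D0 s e leq_refl
        by (auto simp: e_def[symmetric] w_def)
    next
      case (Suc j)
      then obtain m where m: "m \<in> e ` {..j}" "\<forall>i\<le>j. m \<preceq> e i"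
        "(concat (map w [0..<Suc j]), m) \<in> D (Suc (n j))" by auto
      have "Suc (n j) \<le> n (Suc j)" using n Suc.prems by (auto simp: strict_mono_on_def Suc_le_eq)
      then have x: "(concat (map w [0..<Suc j]), m) \<in> D (n (Suc j))" using m(3) D_mono by blast
      have cmp: "comparable (e (Suc j)) m" using m(1) ch Suc.prems by auto
      have s': "s (Suc j) \<in> T" "\<sigma> (Suc j) \<in> F (n (Suc j))" using s Suc.prems by auto
      have "c (concat (map w [0..<Suc j]) @ w (Suc j)) = colour (lower (e (Suc j)) m)"
        "(concat (map w [0..<Suc j]) @ w (Suc j), lower (e (Suc j)) m) \<in> D (Suc (n (Suc j)))"
        using step[OF x s'] cmp by (simp_all add: e_def w_def)
      moreover have "concat (map w [0..<Suc (Suc j)]) = concat (map w [0..<Suc j]) @ w (Suc j)" by simp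
      moreover have "lower (e (Suc j)) m \<in> e ` {..Suc j}" using m(1) by (auto simp: lower_def)
      moreover have "\<forall>i\<le>Suc j. lower (e (Suc j)) m \<preceq> e i"
        using lower_leq[OF cmp] m(2) leq_trans by (metis le_Suc_eq)
      ultimately show ?case by metis
    qed
    from this[of l] obtain m where m: "m \<in> e ` {..l}" "\<forall>i\<le>l. m \<preceq> e i"
      "c (concat (map w [0..<Suc l])) = colour m" by auto
    have "m = t" using m(1,2) least by (intro leq_antisym) auto
    then show "c (concat (map (\<lambda>j. subst_word (\<sigma> j) (b (n j) (s j))) [0..<Suc l])) = colour t"
      using m(3) unfolding w_def subst_word_def by simp
  qed (use b in auto)
qed

end

theorem theorem5p12:
  fixes T L :: "'a set" and r :: 'a and parent :: "'a \<Rightarrow> 'a"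
    and c :: "'a list \<Rightarrow> 'c"
    and d :: "nat \<Rightarrow> nat" and F :: "nat \<Rightarrow> ('a \<Rightarrow> 'a) set"
  assumes "finite_rooted_tree T r parent"
    and "(T - {r}) \<inter> L = {}"
    and "finite (c ` tree_words T r L)"
    and "\<And>n. finite (F n)"
    and "\<And>n \<sigma>. \<sigma> \<in> F n \<Longrightarrow> var_subst T r parent L \<sigma>"
  shows "\<exists>b :: 'a \<Rightarrow> nat \<Rightarrow> 'a list.
     (\<forall>t\<in>T. \<forall>n. b t n \<in> tree_words_at T r parent L t) \<and>
     \<comment> \<open>if \<open>L\<close> is empty then the only word in \<open>tree_words_at T r parent L r\<close> is the empty one\<close>
     (\<forall>n. \<forall>t\<in>T. t \<noteq> r \<or> L \<noteq> {} \<longrightarrow> d n \<le> length (b t n)) \<and>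
     (\<exists>colour :: 'a \<Rightarrow> 'c.
        \<forall>(l::nat) (n :: nat \<Rightarrow> nat) (s :: nat \<Rightarrow> 'a) (\<sigma> :: nat \<Rightarrow> 'a \<Rightarrow> 'a) t.
          strict_mono_on {..l} n \<longrightarrow>
          (\<forall>j\<le>l. s j \<in> T \<and> \<sigma> j \<in> F (n j)) \<longrightarrow>
          chain_with_least T r parent ((\<lambda>j. induced_map T r (\<sigma> j) (s j)) ` {..l}) t \<longrightarrow>
          c (concat (map (\<lambda>j. subst_word (\<sigma> j) (b (s j) (n j))) [0..<Suc l])) = colour t)"
proof -
  interpret rooted_tree T r parent by unfold_locales (rule assms(1))
  \<comment> \<open>The tree is finite, so absorption up to its maximal depth covers all its
    nodes.\<close>
  obtain w where w: "w \<in> coherent L"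
    and left: "\<And>i k. i \<le> k \<Longrightarrow> k \<le> Max (depth ` T) \<Longrightarrow> w i \<star> w k = w k"
    and right: "\<And>i k. i \<le> k \<Longrightarrow> k \<le> Max (depth ` T) \<Longrightarrow> w k \<star> w i = w k"
    using coherent_ordered_ultrafilters[of L "Max (depth ` T)"] by metis
  have "depth t \<le> Max (depth ` T)" if "t \<in> T" for t using that finite_T by simp
  then interpret tree_ultrafilters T r parent L w
    by unfold_locales (use assms(2) w left right in auto)
  show ?thesis
  proof (rule ramsey[where d = d and F = F, OF assms(3-5)])
    fix b and colour :: "'a \<Rightarrow> 'c"
    assume b: "\<And>t n. t \<in> T \<Longrightarrow> b t n \<in> tree_words_at T r parent L t"
      "\<And>t n. t \<in> T \<Longrightarrow> t \<noteq> r \<or> L \<noteq> {} \<Longrightarrow> d n \<le> length (b t n)"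
      "\<And>(l::nat) n s \<sigma> t. strict_mono_on {..l} n \<Longrightarrow> \<forall>j\<le>l. s j \<in> T \<and> \<sigma> j \<in> F (n j) \<Longrightarrow>
         chain_with_least T r parent ((\<lambda>j. induced_map T r (\<sigma> j) (s j)) ` {..l}) t \<Longrightarrow>
         c (concat (map (\<lambda>j. subst_word (\<sigma> j) (b (s j) (n j))) [0..<Suc l])) = colour t"
    show ?thesis
      by (intro exI[of _ b] conjI exI[of _ colour] ballI allI impI) (rule b; assumption)+
  qed
qed

end
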